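(* Let $M$ be a number field and $\mathcal O_M$ the ring of integers of $M$. For a given integer $m\in\mathcal O_M$ with $m^2+3m+9\ne0$, there exist only finitely many integers $n\in\mathcal O_M$ such that the splitting fields over $M$ of $X^3-mX^2-(m+3)X-1$ and of $X^3-nX^2-(n+3)X-1$ coincide.
   Context: Splitting fields are taken in a fixed algebraic closure of $M$. The discriminant of $X^3-mX^2-(m+3)X-1$ is $(m^2+3m+9)^2$. *)

theory Defs
  imports "HOL-Algebra.Algebraic_Closure_Type" "HOL-Algebra.Generated_Fields"
begin

text \<open>
  The number field $M$ is the whole of a type of class \<^class>\<open>field_char_0\<close>; its ring of
  integers is then the set of all its elements satisfying \<^const>\<open>algebraic_int\<close>.
\<close>

definition number_field :: "'a::field_char_0 itself \<Rightarrow> bool" where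
  "number_field TYPE('a) \<longleftrightarrow>
     (\<exists>B::'a set. finite_dimensional_vector_space (\<lambda>(q::rat) x. of_rat q * x) B)"

text \<open>
  The type \<open>'a alg_closure\<close> is the fixed algebraic closure of \<open>'a\<close>, with embedding \<^const>\<open>to_ac\<close>.
  Splitting fields are subsets of it, so that two of them coincide iff they are equal as sets.
  The definition is meaningful for nonzero \<open>p\<close>.
\<close>

definition splitting_field :: "'a::field poly \<Rightarrow> 'a alg_closure set" where
  "splitting_field p =
     generate_field ring_of_type_algebra
       (range to_ac \<union> {x. poly (map_poly to_ac p) x = 0})"

definition simplest_cubic :: "'a::comm_ring_1 \<Rightarrow> 'a poly" where
  "simplest_cubic m = [: -1, - (m + 3), - m, 1 :]"

lemma poly_simplest_cubic:
  "poly (simplest_cubic m) x = x ^ 3 - m * x ^ 2 - (m + 3) * x - 1"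
  by (simp add: simplest_cubic_def algebra_simps power2_eq_square power3_eq_cube)

lemma splitting_field_subfield:
  "subfield (splitting_field p) ring_of_type_algebra"
  unfolding splitting_field_def
  by (rule field.generate_field_is_subfield[OF field_from_type_algebra])
     (simp add: ring_of_type_algebra_def)

lemma splitting_field_least:
  fixes p :: "'a::field poly" and E :: "'a alg_closure set"
  assumes "subfield E ring_of_type_algebra" "range to_ac \<subseteq> E"
    and "\<And>x. poly (map_poly to_ac p) x = 0 \<Longrightarrow> x \<in> E"
  shows "splitting_field p \<subseteq> E"
  unfolding splitting_field_def
  by (rule field.generate_field_min_subfield1[OF field_from_type_algebra])
     (use assms in \<open>auto simp: ring_of_type_algebra_def\<close>)

end

theory Submission
  imports Defs "Jordan_Normal_Form.Char_Poly" "HOL-Computational_Algebra.Formal_Laurent_Series"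
begin

text \<open>
  If \<open>n\<close> is integral and \<open>z\<close> is a root of \<open>X\<^sup>3 - n X\<^sup>2 - (n + 3) X - 1\<close>, then \<open>z\<close> and \<open>1 + z\<close> are
  units and \<open>n = (z\<^sup>3 - 3 z - 1) / (z\<^sup>2 + z)\<close>. When the splitting field is prescribed, all these \<open>z\<close>
  lie in one number field \<open>L\<close>, and it remains to see that \<open>x + y = 1\<close> has only finitely many
  solutions in units of \<open>L\<close>. This is done with the method of Beukers and Schlickewei. From the vanishing of
  the sum of the residues of \<open>1 / ((t - a)\<^sup>l (t - b)\<^sup>m (t - c)\<^sup>n)\<close> one gets integral relations
  \<open>A x\<^sup>k + B y\<^sup>k + C = 0\<close> on the line \<open>x + y = 1\<close> with \<open>A, B, C\<close> of degree about \<open>k / 2\<close>. If \<open>(x', y')\<close>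
  is another solution, comparing such a relation with \<open>\<epsilon> x\<^sup>k + \<eta> y\<^sup>k = 1\<close>, where \<open>\<epsilon> = x' / x\<^sup>k\<close> and
  \<open>\<eta> = y' / y\<^sup>k\<close>, gives a nonzero algebraic integer \<open>A \<eta> - B \<epsilon>\<close>; as its norm is at least \<open>1\<close>, the
  height of \<open>(\<epsilon>, \<eta>)\<close> is at least about \<open>k / 2\<close> times that of \<open>(x, y)\<close>. But among infinitely many
  solutions there are two whose logarithmic vectors are almost parallel with a large quotient \<open>\<rho>\<close>
  of heights, and an odd \<open>k\<close> just below \<open>\<rho>\<close> makes the height of \<open>(\<epsilon>, \<eta>)\<close> too small.
\<close>

section \<open>Integral elements\<close>

text \<open>Integrality is developed over the image of an arbitrary homomorphism, since
  \<open>int\<close> yields the algebraic integers and \<open>rat\<close> the algebraic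
  numbers.\<close>

locale comm_ring_hom_field = comm_ring_hom hom for hom :: "'a::comm_ring_1 \<Rightarrow> 'b::field"
begin

definition hom_integral :: "'b \<Rightarrow> bool" where
  "hom_integral x \<longleftrightarrow> (\<exists>p. lead_coeff p = 1 \<and> poly (map_poly hom p) x = 0)"

definition hom_span :: "('i \<Rightarrow> 'b) \<Rightarrow> 'i set \<Rightarrow> 'b set" where
  "hom_span v I = range (\<lambda>c. \<Sum>i\<in>I. hom (c i) * v i)"

lemma hom_span_add: "y \<in> hom_span v I \<Longrightarrow> z \<in> hom_span v I \<Longrightarrow> y + z \<in> hom_span v I"
  unfolding hom_span_def
  by (clarsimp, rule_tac x = "\<lambda>i. c i + ca i" in range_eqI) (simp add: hom_add distrib_right sum.distrib)

lemma hom_span_scale: "y \<in> hom_span v I \<Longrightarrow> hom r * y \<in> hom_span v I"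
  unfolding hom_span_def
  by (clarsimp, rule_tac x = "\<lambda>i. r * c i" in range_eqI) (simp add: hom_mult mult.assoc sum_distrib_left)

lemma hom_span_0: "0 \<in> hom_span v I"
  unfolding hom_span_def by (rule range_eqI[of _ _ "\<lambda>_. 0"]) simp

lemma hom_span_sum: "(\<And>j. j \<in> J \<Longrightarrow> f j \<in> hom_span v I) \<Longrightarrow> sum f J \<in> hom_span v I"
  by (induction J rule: infinite_finite_induct) (auto simp: hom_span_0 hom_span_add)

lemma hom_span_base: "finite I \<Longrightarrow> i \<in> I \<Longrightarrow> v i \<in> hom_span v I"
  unfolding hom_span_def
  by (rule range_eqI[of _ _ "\<lambda>j. if j = i then 1 else 0"])
    (simp add: if_distrib[of hom] if_distrib[of "\<lambda>c. c * _"] cong: if_cong)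

lemma hom_span_mult_closed:
  assumes "\<And>i. i \<in> I \<Longrightarrow> x * v i \<in> hom_span v I" "y \<in> hom_span v I"
  shows "x * y \<in> hom_span v I"
proof -
  obtain c where y: "y = (\<Sum>i\<in>I. hom (c i) * v i)" using assms(2) unfolding hom_span_def by blast
  have "x * y = (\<Sum>i\<in>I. hom (c i) * (x * v i))" unfolding y by (simp add: sum_distrib_left mult_ac)
  then show ?thesis using assms(1) by (auto intro!: hom_span_sum hom_span_scale)
qed

text \<open>Such an \<open>x\<close> is an eigenvalue of a matrix with entries in \<open>'a\<close>.\<close>

lemma hom_integralI:
  assumes "finite I" "i0 \<in> I" "v i0 \<noteq> 0" and cl: "\<And>i. i \<in> I \<Longrightarrow> x * v i \<in> hom_span v I"
  shows "hom_integral x"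
proof -
  define n where "n = card I"
  obtain e where e: "bij_betw e {..<n} I"
    using ex_bij_betw_nat_finite[OF assms(1)] by (auto simp: n_def atLeast0LessThan)
  have "\<forall>i\<in>I. \<exists>c. x * v i = (\<Sum>j\<in>I. hom (c j) * v j)"
    using cl by (auto simp: hom_span_def image_iff)
  then obtain c where c: "\<And>i. i \<in> I \<Longrightarrow> x * v i = (\<Sum>j\<in>I. hom (c i j) * v j)" by metis
  define A where "A = mat n n (\<lambda>(i, j). c (e i) (e j))"
  define w where "w = vec n (\<lambda>i. v (e i))"
  have A: "A \<in> carrier_mat n n" by (simp add: A_def)
  have hA: "map_mat hom A \<in> carrier_mat n n" by (simp add: A_def)
  have ei: "e i \<in> I" if "i < n" for i using e that by (auto simp: bij_betw_def)
  have "map_mat hom A *\<^sub>v w = x \<cdot>\<^sub>v w"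
  proof (rule eq_vecI)
    fix i assume "i < dim_vec (x \<cdot>\<^sub>v w)"
    then have i: "i < n" by (simp add: w_def)
    have "(map_mat hom A *\<^sub>v w) $ i = (\<Sum>j<n. hom (c (e i) (e j)) * v (e j))"
      using i by (simp add: A_def w_def scalar_prod_def atLeast0LessThan)
    also have "\<dots> = (\<Sum>j\<in>I. hom (c (e i) j) * v j)"
      by (rule sum.reindex_bij_betw[OF e, of "\<lambda>j. hom (c (e i) j) * v j"])
    finally show "(map_mat hom A *\<^sub>v w) $ i = (x \<cdot>\<^sub>v w) $ i"
      using c[OF ei[OF i]] i by (simp add: w_def)
  qed (simp add: A_def w_def)
  moreover have "w \<noteq> 0\<^sub>v n"
  proof -
    obtain i where "i < n" "e i = i0" using e assms(2) by (auto simp: bij_betw_def image_iff)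
    then have "w $ i \<noteq> 0\<^sub>v n $ i" using assms(3) by (simp add: w_def)
    then show ?thesis by metis
  qed
  ultimately have "eigenvalue (map_mat hom A) x"
    unfolding eigenvalue_def eigenvector_def using A by (intro exI[of _ w]) (auto simp: w_def)
  then have "poly (char_poly (map_mat hom A)) x = 0"
    using eigenvalue_root_char_poly[OF hA] by simp
  then show ?thesis
    unfolding hom_integral_def char_poly_hom[OF A] using degree_monic_char_poly[OF A] by auto
qed

text \<open>Multiplying the monic equation by \<open>x ^ (k - degree p)\<close> expresses
  \<open>x ^ k\<close> through strictly smaller powers, the form in which it drives inductions on
  exponents.\<close>

lemma hom_integral_power:
  assumes "lead_coeff p = 1" "poly (map_poly hom p) x = 0" "degree p \<le> k"
  shows "x ^ k = (\<Sum>i<degree p. hom (- coeff p i) * x ^ (k - degree p + i))"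
proof -
  have d: "degree (map_poly hom p) = degree p"
    by (rule degree_map_poly) (use assms in auto)
  have "0 = (\<Sum>i\<le>degree p. hom (coeff p i) * x ^ i)"
    using assms(2) unfolding poly_altdef d by (simp add: coeff_map_poly)
  also have "\<dots> = (\<Sum>i<degree p. hom (coeff p i) * x ^ i) + x ^ degree p"
    using assms(1) by (simp add: lessThan_Suc_atMost[symmetric])
  finally have "x ^ degree p = (\<Sum>i<degree p. hom (- coeff p i) * x ^ i)"
    by (simp add: hom_uminus sum_negf eq_neg_iff_add_eq_0 add.commute)
  then have "x ^ (k - degree p) * x ^ degree p = (\<Sum>i<degree p. hom (- coeff p i) * x ^ (k - degree p + i))"
    by (simp add: sum_distrib_left power_add mult_ac)
  then show ?thesis using assms(3) by (simp flip: power_add)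
qed

text \<open>The monomials \<open>x ^ i * y ^ j\<close> below the two degrees span a module stable
  under multiplication by \<open>x\<close> and by \<open>y\<close>, so \<open>hom_integralI\<close>
  applies to the sum and to the product.\<close>

lemma hom_integral_add_mult:
  assumes "hom_integral x" "hom_integral y"
  shows "hom_integral (x + y)" "hom_integral (x * y)"
proof -
  obtain p q where p: "lead_coeff p = 1" "poly (map_poly hom p) x = 0"
    and q: "lead_coeff q = 1" "poly (map_poly hom q) y = 0"
    using assms unfolding hom_integral_def by auto
  \<comment> \<open>A monic polynomial with a root is not constant; hence the monomial 1 belongs to
    the family and serves as its nonzero member.\<close>
  have pos: "degree r > 0" if "lead_coeff r = 1" "poly (map_poly hom r) z = 0" for r z
    using that by (auto elim!: degree_eq_zeroE intro!: gr0I)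
  define I where "I = {..<degree p} \<times> {..<degree q}"
  define v where "v = (\<lambda>(i, j). x ^ i * y ^ j)"
  have fin: "finite I" by (simp add: I_def)
  have 0: "(0, 0) \<in> I" using pos[OF p] pos[OF q] by (simp add: I_def)
  have S: "x ^ k * y ^ l \<in> hom_span v I" for k l
  proof (induction k arbitrary: l rule: less_induct)
    case (less k)
    show ?case
    proof (cases "k < degree p")
      case True
      then show ?thesis
      proof (induction l rule: less_induct)
        case (less l)
        show ?case
        proof (cases "l < degree q")
          case True
          then show ?thesis using less.prems hom_span_base[OF fin, of "(k, l)" v] by (simp add: I_def v_def)
        next
          case False
          have "x ^ k * y ^ l = (\<Sum>i<degree q. hom (- coeff q i) * (x ^ k * y ^ (l - degree q + i)))"
            using False by (subst hom_integral_power[OF q]) (simp_all add: sum_distrib_left mult_ac)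
          then show ?thesis using False less by (auto intro!: hom_span_sum hom_span_scale)
        qed
      qed
    next
      case False
      have "x ^ k * y ^ l = (\<Sum>i<degree p. hom (- coeff p i) * (x ^ (k - degree p + i) * y ^ l))"
      proof -
        have le: "degree p \<le> k" using False by simp
        show ?thesis
          by (subst hom_integral_power[OF p le]) (simp only: sum_distrib_right mult.assoc)
      qed
      then show ?thesis using False less by (auto intro!: hom_span_sum hom_span_scale)
    qed
  qed
  have x: "x * v i \<in> hom_span v I" for i using S[of "Suc (fst i)" "snd i"] by (simp add: v_def split_beta mult_ac)
  have y: "y * v i \<in> hom_span v I" for i using S[of "fst i" "Suc (snd i)"] by (simp add: v_def split_beta mult_ac)
  show "hom_integral (x + y)"
    using hom_integralI[OF fin 0, of v "x + y"] x y by (simp add: v_def distrib_right hom_span_add)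
  show "hom_integral (x * y)"
    using hom_integralI[OF fin 0, of v "x * y"] hom_span_mult_closed[of I x v, OF x y]
    by (simp add: v_def mult.assoc)
qed

end

section \<open>Algebraic numbers and algebraic integers\<close>

interpretation int_integral: comm_ring_hom_field "of_int :: int \<Rightarrow> 'a::field_char_0" ..

interpretation rat_integral: comm_ring_hom_field "of_rat :: rat \<Rightarrow> 'a::field_char_0"
  by unfold_locales (auto simp: of_rat_add of_rat_mult)

lemma algebraic_int_iff_hom_integral:
  "algebraic_int (x :: 'a::field_char_0) \<longleftrightarrow> int_integral.hom_integral x"
  unfolding algebraic_int_altdef_ipoly int_integral.hom_integral_def by auto

lemma algebraic_iff_hom_integral:
  "algebraic (x :: 'a::field_char_0) \<longleftrightarrow> rat_integral.hom_integral x"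
proof
  assume "algebraic x"
  then obtain p where p: "p \<noteq> 0" "poly (map_poly of_int p) x = 0" by (elim algebraicE')
  let ?q = "map_poly of_int p :: rat poly"
  have "poly (map_poly of_rat (smult (inverse (lead_coeff ?q)) ?q)) x = 0"
    using p by (simp add: map_poly_smult of_rat_mult map_poly_map_poly o_def)
  moreover have "lead_coeff (smult (inverse (lead_coeff ?q)) ?q) = 1"
    using p by simp
  ultimately show "rat_integral.hom_integral x" unfolding rat_integral.hom_integral_def by blast
next
  assume "rat_integral.hom_integral x"
  then obtain p :: "rat poly" where "lead_coeff p = 1" "poly (map_poly of_rat p) x = 0"
    unfolding rat_integral.hom_integral_def by auto
  then show "algebraic x"
    by (intro algebraicI'[of "map_poly of_rat p"]) (auto simp: coeff_map_poly)
qed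

lemmas algebraic_int_add = int_integral.hom_integral_add_mult(1)[folded algebraic_int_iff_hom_integral]
lemmas algebraic_int_mult = int_integral.hom_integral_add_mult(2)[folded algebraic_int_iff_hom_integral]
lemmas algebraic_add = rat_integral.hom_integral_add_mult(1)[folded algebraic_iff_hom_integral]
lemmas algebraic_mult = rat_integral.hom_integral_add_mult(2)[folded algebraic_iff_hom_integral]

lemma algebraic_int_diff: "algebraic_int x \<Longrightarrow> algebraic_int y \<Longrightarrow> algebraic_int (x - y :: 'a::field_char_0)"
  using algebraic_int_add[of x "- y"] by simp

lemma algebraic_int_power: "algebraic_int x \<Longrightarrow> algebraic_int (x ^ k :: 'a::field_char_0)"
  by (induction k) (auto intro: algebraic_int_mult)

lemma algebraic_int_prod: "(\<And>i. i \<in> I \<Longrightarrow> algebraic_int (f i :: 'a::field_char_0)) \<Longrightarrow> algebraic_int (prod f I)"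
  by (induction I rule: infinite_finite_induct) (auto intro: algebraic_int_mult)

section \<open>Simple extensions of the rational numbers\<close>

definition rpoly :: "rat poly \<Rightarrow> 'a::field_char_0 \<Rightarrow> 'a" where
  "rpoly q x = poly (map_poly of_rat q) x"

text \<open>This is the ring \<rat>[x], which is the field \<rat>(x) once \<open>x\<close> is
  algebraic.\<close>

definition rat_adjoin :: "'a::field_char_0 \<Rightarrow> 'a set" where
  "rat_adjoin x = range (\<lambda>q. rpoly q x)"

lemma rpoly_add [simp]: "rpoly (p + q) x = rpoly p x + rpoly q x"
proof -
  have "map_poly of_rat (p + q) = map_poly of_rat p + map_poly (of_rat :: rat \<Rightarrow> 'a) q"
    by (rule poly_eqI) (simp add: coeff_map_poly of_rat_add)
  then show ?thesis by (simp add: rpoly_def)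
qed

lemma rpoly_mult [simp]: "rpoly (p * q) x = rpoly p x * rpoly q x"
proof -
  have "map_poly of_rat (p * q) = map_poly of_rat p * map_poly (of_rat :: rat \<Rightarrow> 'a) q"
    by (rule poly_eqI) (simp add: coeff_map_poly coeff_mult of_rat_sum of_rat_mult)
  then show ?thesis by (simp add: rpoly_def)
qed

lemma rpoly_0 [simp]: "rpoly 0 x = 0" and rpoly_1 [simp]: "rpoly 1 x = 1"
  and rpoly_const [simp]: "rpoly [:c:] x = of_rat c" and rpoly_X [simp]: "rpoly [:0, 1:] x = x"
  and rpoly_smult [simp]: "rpoly (smult c q) x = of_rat c * rpoly q x"
  by (cases "c = 0"; simp add: rpoly_def map_poly_pCons map_poly_smult of_rat_mult)+

lemma rpoly_minus [simp]: "rpoly (- q) x = - rpoly q x"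
  using rpoly_smult[of "-1" q x] by (simp add: of_rat_minus)

lemma rpoly_diff [simp]: "rpoly (p - q) x = rpoly p x - rpoly q x"
  using rpoly_add[of p "- q" x] by simp

lemma rpoly_altdef: "rpoly q x = (\<Sum>i\<le>degree q. of_rat (coeff q i) * x ^ i)"
  by (simp add: rpoly_def poly_altdef coeff_map_poly)

lemma rpoly_monom [simp]: "rpoly (monom c k) x = of_rat c * x ^ k"
  by (simp add: rpoly_def poly_monom)

text \<open>A nonzero annihilating polynomial of least degree: division with remainder gives
  divisibility, and a proper factor vanishing at \<open>x\<close> would have smaller degree.\<close>

lemma minimal_polynomial:
  assumes "algebraic x"
  obtains p where "irreducible p" "\<And>q. rpoly q x = 0 \<longleftrightarrow> p dvd q"
proof -
  obtain p0 :: "rat poly" where p0: "lead_coeff p0 = 1" "rpoly p0 x = 0"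
    using assms unfolding algebraic_iff_hom_integral rat_integral.hom_integral_def rpoly_def by auto
  obtain p where p: "p \<noteq> 0" "rpoly p x = 0"
    and min: "\<And>q. q \<noteq> 0 \<Longrightarrow> rpoly q x = 0 \<Longrightarrow> degree p \<le> degree q"
  proof -
    have "p0 \<noteq> 0 \<and> rpoly p0 x = 0" using p0 by auto
    from ex_has_least_nat[of "\<lambda>q. q \<noteq> 0 \<and> rpoly q x = 0", OF this] show ?thesis using that by blast
  qed
  have dvd: "rpoly q x = 0 \<longleftrightarrow> p dvd q" for q
  proof
    assume "p dvd q"
    then show "rpoly q x = 0" using p by (auto elim: dvdE)
  next
    assume q: "rpoly q x = 0"
    have "rpoly (q div p * p + q mod p) x = 0" unfolding div_mult_mod_eq by (rule q)
    then have "rpoly (q mod p) x = 0" unfolding rpoly_add rpoly_mult p(2) by simp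
    then have "q mod p = 0"
      using min[of "q mod p"] degree_mod_less[OF p(1), of q] by (meson leD)
    then show "p dvd q" by (simp add: dvd_eq_mod_eq_0)
  qed
  have "irreducible p"
  proof (rule irreducibleI)
    show "p \<noteq> 0" by (rule p)
    show "\<not> p dvd 1" using dvd[of 1] by simp
    fix a b assume ab: "p = a * b"
    then have nz: "a \<noteq> 0" "b \<noteq> 0" using p by auto
    have "rpoly a x = 0 \<or> rpoly b x = 0" using p ab by simp
    then have "degree p \<le> degree a \<or> degree p \<le> degree b" using min nz by blast
    then have "degree a = 0 \<or> degree b = 0" using ab nz by (auto simp: degree_mult_eq)
    then show "a dvd 1 \<or> b dvd 1" using nz by (auto simp: is_unit_iff_degree)
  qed
  then show ?thesis using that dvd by blast
qed

lemma coprime_bezout_rat_poly: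
  fixes p q :: "rat poly"
  assumes "irreducible p" "\<not> p dvd q"
  obtains a b where "a * p + b * q = 1"
proof -
  have "coprime p q" using assms by (metis irreducible_imp_prime_elem prime_elem_imp_coprime)
  then show ?thesis using that by (metis bezout_coefficients_fst_snd coprime_iff_gcd_eq_1)
qed

text \<open>In characteristic 0 the derivative is nonzero of smaller degree, hence coprime to
  \<open>p\<close>; a Bezout identity evaluated at \<open>z\<close> excludes a common root.\<close>

lemma irreducible_simple_roots:
  assumes "irreducible p" "rpoly p z = 0"
  shows "rpoly (pderiv p) z \<noteq> 0"
proof -
  have d: "degree p \<noteq> 0"
    using assms by (metis is_unit_iff_degree irreducible_def)
  then have "pderiv p \<noteq> 0" by (simp add: pderiv_eq_0_iff)
  moreover have "degree (pderiv p) < degree p" using d by (simp add: degree_pderiv)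
  ultimately have "\<not> p dvd pderiv p" by (meson dvd_imp_degree_le leD)
  then obtain a b where "a * p + b * pderiv p = 1" using coprime_bezout_rat_poly[OF assms(1)] by blast
  from arg_cong[OF this, of "\<lambda>r. rpoly r z"] show ?thesis using assms(2) by auto
qed

section \<open>Arithmetic in \<rat>(x)\<close>

lemma rat_adjoin_add: "y \<in> rat_adjoin x \<Longrightarrow> z \<in> rat_adjoin x \<Longrightarrow> y + z \<in> rat_adjoin x"
  unfolding rat_adjoin_def by (auto simp flip: rpoly_add)

lemma rat_adjoin_mult: "y \<in> rat_adjoin x \<Longrightarrow> z \<in> rat_adjoin x \<Longrightarrow> y * z \<in> rat_adjoin x"
  unfolding rat_adjoin_def by (auto simp flip: rpoly_mult)

lemma rat_adjoin_minus: "y \<in> rat_adjoin x \<Longrightarrow> - y \<in> rat_adjoin x"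
  unfolding rat_adjoin_def by (auto simp flip: rpoly_minus)

lemma rat_adjoin_diff: "y \<in> rat_adjoin x \<Longrightarrow> z \<in> rat_adjoin x \<Longrightarrow> y - z \<in> rat_adjoin x"
  unfolding rat_adjoin_def by (auto simp flip: rpoly_diff)

lemma rat_adjoin_of_rat [simp]: "of_rat c \<in> rat_adjoin x"
  unfolding rat_adjoin_def by (metis rpoly_const rangeI)

lemma rat_adjoin_self [simp]: "x \<in> rat_adjoin x"
  unfolding rat_adjoin_def by (metis rpoly_X rangeI)

lemma rat_adjoin_0 [simp]: "0 \<in> rat_adjoin x" and rat_adjoin_1 [simp]: "1 \<in> rat_adjoin x"
  and rat_adjoin_of_nat [simp]: "of_nat n \<in> rat_adjoin x"
  using rat_adjoin_of_rat[of 0 x] rat_adjoin_of_rat[of 1 x] rat_adjoin_of_rat[of "of_nat n" x] by simp_all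

lemma rat_adjoin_sum: "(\<And>i. i \<in> I \<Longrightarrow> f i \<in> rat_adjoin x) \<Longrightarrow> sum f I \<in> rat_adjoin x"
  by (induction I rule: infinite_finite_induct) (auto intro: rat_adjoin_add)

lemma rat_adjoin_power: "y \<in> rat_adjoin x \<Longrightarrow> y ^ k \<in> rat_adjoin x"
  by (induction k) (auto intro: rat_adjoin_mult)

text \<open>A Bezout identity between the minimal polynomial of \<open>x\<close> and a polynomial
  representing \<open>y\<close> becomes, at \<open>x\<close>, an explicit inverse.\<close>

lemma rat_adjoin_inverse:
  assumes "algebraic x" "y \<in> rat_adjoin x"
  shows "inverse y \<in> rat_adjoin x"
proof (cases "y = 0")
  case False
  obtain q where y: "y = rpoly q x" using assms(2) unfolding rat_adjoin_def by blast
  obtain p where p: "irreducible p" "\<And>q. rpoly q x = 0 \<longleftrightarrow> p dvd q" using minimal_polynomial[OF assms(1)] by blast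
  obtain a b where ab: "a * p + b * q = 1"
    using coprime_bezout_rat_poly[OF p(1), of q] p(2)[of q] False y by auto
  from arg_cong[OF ab, of "\<lambda>r. rpoly r x"] have "rpoly b x * y = 1" using p(2)[of p] y by simp
  then have "inverse y = rpoly b x" by (metis inverse_unique mult.commute)
  then show ?thesis unfolding rat_adjoin_def by blast
qed simp

lemma rat_adjoin_mono:
  assumes "y \<in> rat_adjoin x"
  shows "rat_adjoin y \<subseteq> rat_adjoin x"
proof -
  have "rpoly q y \<in> rat_adjoin x" for q
    unfolding rpoly_altdef by (intro rat_adjoin_sum rat_adjoin_mult rat_adjoin_power assms) simp
  then show ?thesis by (auto simp: rat_adjoin_def)
qed

text \<open>\<open>mod\<close> is taken over the whole type; following long division step by step
  shows that the coefficients never leave the subfield.\<close>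

lemma rat_adjoin_poly_mod:
  fixes h u :: "'a::field_char_0 poly"
  assumes x: "algebraic x" and h: "\<And>i. coeff h i \<in> rat_adjoin x" "h \<noteq> 0"
    and u: "\<And>i. coeff u i \<in> rat_adjoin x"
  shows "coeff (u mod h) i \<in> rat_adjoin x"
  using u
proof (induction "degree u" arbitrary: u rule: less_induct)
  case less
  show ?case
  proof (cases "degree u < degree h")
    case True
    then show ?thesis using less.prems by (simp add: mod_poly_less)
  next
    case False
    define c where "c = monom (lead_coeff u / lead_coeff h) (degree u - degree h)"
    define u' where "u' = u - c * h"
    have eq: "u mod h = u' mod h"
      unfolding u'_def by (simp add: mod_diff_eq[symmetric] flip: mod_diff_left_eq)
    have cf: "coeff u' i \<in> rat_adjoin x" for i
    proof -
      define a where "a = lead_coeff u / lead_coeff h"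
      have "a \<in> rat_adjoin x"
        unfolding a_def divide_inverse using h less.prems x by (intro rat_adjoin_mult rat_adjoin_inverse) auto
      then show ?thesis
        unfolding u'_def c_def coeff_diff coeff_monom_mult a_def[symmetric]
        using h less.prems by (auto intro!: rat_adjoin_diff rat_adjoin_mult)
    qed
    show ?thesis
    proof (cases "u' = 0")
      case True
      then show ?thesis using eq by simp
    next
      case u': False
      show ?thesis
      \<comment> \<open>Here the degree cannot drop any further, but \<open>h\<close> is then a
        nonzero constant and the remainder vanishes.\<close>
      proof (cases "degree u = 0")
        case True
        then have "degree h = 0" using False by simp
        then show ?thesis using h(2)
          by (metis coeff_0 is_unit_iff_degree rat_adjoin_0 mod_eq_0_iff_dvd unit_imp_dvd)
      next
        case du: False
        have "degree u' < degree u"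
        proof -
          have "coeff u' (degree u) = 0"
            using False h(2) by (simp add: u'_def c_def coeff_monom_mult)
          moreover have "degree u' \<le> degree u"
          proof -
            have "degree (c * h) \<le> degree u"
              using False by (intro order.trans[OF degree_mult_le])
                (simp add: c_def degree_monom_eq order.trans[OF add_right_mono[OF degree_monom_le]])
            then show ?thesis unfolding u'_def by (intro degree_diff_le) auto
          qed
          ultimately show ?thesis using u' by (metis le_neq_implies_less leading_coeff_0_iff)
        qed
        then show ?thesis using less.hyps[of u'] cf eq by simp
      qed
    qed
  qed
qed

text \<open>The gcd, computed over \<open>\<rat>(\<gamma>)\<close>, of the minimal polynomial of \<open>\<beta>\<close> and of
  \<open>f(\<gamma> - c X)\<close>, with \<open>f\<close> the minimal polynomial of \<open>\<alpha>\<close>, is \<open>X - \<beta>\<close>.\<close>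

theorem primitive_element:
  fixes \<alpha> \<beta> :: "'a::{alg_closed_field, field_char_0}"
  assumes "algebraic \<alpha>" "algebraic \<beta>"
  obtains \<gamma> where "algebraic \<gamma>" "\<alpha> \<in> rat_adjoin \<gamma>" "\<beta> \<in> rat_adjoin \<gamma>"
proof -
  obtain f where f: "irreducible f" "\<And>q. rpoly q \<alpha> = 0 \<longleftrightarrow> f dvd q"
    using minimal_polynomial[OF assms(1)] by blast
  obtain g where g: "irreducible g" "\<And>q. rpoly q \<beta> = 0 \<longleftrightarrow> g dvd q"
    using minimal_polynomial[OF assms(2)] by blast
  define F :: "'a poly" where "F = map_poly of_rat f"
  define G :: "'a poly" where "G = map_poly of_rat g"
  have F: "F \<noteq> 0" "poly F z = rpoly f z" for z
    using f(1) by (auto simp: F_def rpoly_def irreducible_def map_poly_eq_0_iff)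
  have G: "G \<noteq> 0" "poly G z = rpoly g z" for z
    using g(1) by (auto simp: G_def rpoly_def irreducible_def map_poly_eq_0_iff)
  have \<alpha>: "poly F \<alpha> = 0" and \<beta>: "poly G \<beta> = 0" using F G f(2)[of f] g(2)[of g] by auto
  \<comment> \<open>The values of \<open>c\<close> for which \<open>\<gamma> - c * b\<close> is a
    root of \<open>F\<close> for some root \<open>b \<noteq> \<beta>\<close> of \<open>G\<close>.
    Pairs with \<open>b = \<beta>\<close> contribute the value 0 of a division by zero.\<close>
  define bad where "bad = (\<lambda>(a, b). (a - \<alpha>) / (\<beta> - b)) ` ({a. poly F a = 0} \<times> {b. poly G b = 0})"
  have "finite bad" unfolding bad_def by (intro finite_imageI finite_cartesian_product poly_roots_finite F G)
  moreover have "infinite (range (of_nat :: nat \<Rightarrow> 'a))" by (simp add: range_inj_infinite inj_of_nat)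
  ultimately obtain c :: nat where c: "of_nat c \<notin> bad" by (metis finite_subset image_subset_iff)
  define \<gamma> where "\<gamma> = \<alpha> + of_nat c * \<beta>"
  have "algebraic (of_nat c :: 'a)"
    by (intro algebraic_int_imp_algebraic int_imp_algebraic_int) auto
  then have alg: "algebraic \<gamma>" unfolding \<gamma>_def using assms by (intro algebraic_add algebraic_mult)
  define H where "H = F \<circ>\<^sub>p [:\<gamma>, - of_nat c:]"
  have sepa: "\<rho> = \<beta>" if "poly G \<rho> = 0" "poly H \<rho> = 0" for \<rho>
  proof (rule ccontr)
    assume "\<rho> \<noteq> \<beta>"
    then have "of_nat c = (\<gamma> - of_nat c * \<rho> - \<alpha>) / (\<beta> - \<rho>)" by (simp add: \<gamma>_def field_simps)
    moreover have "poly F (\<gamma> - of_nat c * \<rho>) = 0" using that(2) by (simp add: H_def poly_pcompose mult.commute)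
    ultimately have "of_nat c \<in> bad" unfolding bad_def using that(1) by force
    then show False using c by simp
  qed
  define PL where "PL = {h :: 'a poly. \<forall>i. coeff h i \<in> rat_adjoin \<gamma>}"
  have GL: "G \<in> PL" by (simp add: PL_def G_def coeff_map_poly)
  have HL: "H \<in> PL"
  proof -
    have mul: "u * v \<in> PL" if "u \<in> PL" "v \<in> PL" for u v
      using that unfolding PL_def by (auto simp: coeff_mult intro!: rat_adjoin_sum rat_adjoin_mult)
    have add: "u + v \<in> PL" if "u \<in> PL" "v \<in> PL" for u v
      using that unfolding PL_def by (auto intro!: rat_adjoin_add)
    have const: "[:k:] \<in> PL" if "k \<in> rat_adjoin \<gamma>" for k
      using that unfolding PL_def by (auto simp: coeff_pCons split: nat.splits)
    have lin: "[:\<gamma>, - of_nat c:] \<in> PL"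
      unfolding PL_def by (auto simp: coeff_pCons intro: rat_adjoin_minus split: nat.splits)
    have "u \<circ>\<^sub>p [:\<gamma>, - of_nat c:] \<in> PL" if "u \<in> PL" for u
      using that
    proof (induction u)
      case (pCons a u)
      have "a \<in> rat_adjoin \<gamma>" "u \<in> PL"
        using pCons.prems unfolding PL_def by (force simp: coeff_pCons split: nat.splits)+
      then show ?case unfolding pcompose_pCons by (intro add mul const lin pCons.IH)
    qed (simp add: PL_def)
    moreover have "F \<in> PL" by (simp add: PL_def F_def coeff_map_poly)
    ultimately show ?thesis unfolding H_def by blast
  qed
  \<comment> \<open>\<open>h\<close> is a minimal polynomial of \<open>\<beta>\<close> over
    \<rat>(\<gamma>); it divides both \<open>G\<close> and \<open>H\<close>.\<close>
  obtain h where h: "h \<in> PL" "h \<noteq> 0" "poly h \<beta> = 0"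
    and min: "\<And>u. u \<in> PL \<Longrightarrow> u \<noteq> 0 \<Longrightarrow> poly u \<beta> = 0 \<Longrightarrow> degree h \<le> degree u"
    using ex_has_least_nat[of "\<lambda>h. h \<in> PL \<and> h \<noteq> 0 \<and> poly h \<beta> = 0" G degree] GL G \<beta> by blast
  have dvd: "h dvd u" if u: "u \<in> PL" "poly u \<beta> = 0" for u
  proof -
    have "u mod h \<in> PL" using u h unfolding PL_def by (auto intro: rat_adjoin_poly_mod[OF alg])
    moreover have "poly (u mod h) \<beta> = 0" by (subst poly_mod) (use h u in auto)
    ultimately have "u mod h = 0" using min[of "u mod h"] degree_mod_less[OF h(2), of u] by (meson leD)
    then show ?thesis by (simp add: dvd_eq_mod_eq_0)
  qed
  have hG: "h dvd G" by (rule dvd[OF GL \<beta>])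
  have "poly H \<beta> = 0" using \<alpha> by (simp add: H_def poly_pcompose \<gamma>_def mult.commute)
  then have hH: "h dvd H" by (rule dvd[OF HL])
  obtain k where k: "h = [:- \<beta>, 1:] * k" using h(3) by (auto simp: poly_eq_0_iff_dvd elim: dvdE)
  \<comment> \<open>By \<open>sepa\<close> a root of \<open>k\<close> could only be
    \<open>\<beta>\<close>, which would then be a double root of \<open>G\<close>.\<close>
  have "degree k = 0"
  proof (rule ccontr)
    assume "degree k \<noteq> 0"
    then obtain \<rho> where \<rho>: "poly k \<rho> = 0" using alg_closed_imp_poly_has_root[of k] by auto
    then have "poly h \<rho> = 0" by (simp add: k)
    then have "\<rho> = \<beta>" using hG hH by (intro sepa) (auto elim!: dvdE)
    then obtain k' where "k = [:- \<beta>, 1:] * k'" using \<rho> by (auto simp: poly_eq_0_iff_dvd elim: dvdE)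
    then obtain l where l: "G = [:- \<beta>, 1:] * ([:- \<beta>, 1:] * l)" using hG unfolding k by (metis dvdE mult.assoc)
    have "poly (pderiv G) \<beta> = 0" unfolding l pderiv_mult by simp
    moreover have "poly (pderiv G) \<beta> = rpoly (pderiv g) \<beta>"
      by (simp add: G_def rpoly_def of_rat_hom.map_poly_pderiv)
    ultimately show False using irreducible_simple_roots[OF g(1), of \<beta>] g(2)[of g] by simp
  qed
  then obtain e where e: "k = [:e:]" by (elim degree_eq_zeroE)
  then have e0: "e \<noteq> 0" using h(2) k by auto
  \<comment> \<open>Now \<open>h = e * (X - \<beta>)\<close>, so \<open>\<beta>\<close> is minus the
    quotient of its two coefficients.\<close>
  have "coeff h 0 \<in> rat_adjoin \<gamma>" "coeff h 1 \<in> rat_adjoin \<gamma>" using h(1) by (auto simp: PL_def)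
  moreover have "coeff h 0 = - \<beta> * e" "coeff h 1 = e" by (simp_all add: k e)
  ultimately have "- (coeff h 0 * inverse (coeff h 1)) \<in> rat_adjoin \<gamma>"
    by (intro rat_adjoin_minus rat_adjoin_mult rat_adjoin_inverse alg)
  then have \<beta>L: "\<beta> \<in> rat_adjoin \<gamma>" using e0 unfolding \<open>coeff h 0 = _\<close> \<open>coeff h 1 = _\<close> by (simp add: mult.assoc)
  then have "\<gamma> - of_nat c * \<beta> \<in> rat_adjoin \<gamma>" by (intro rat_adjoin_diff rat_adjoin_mult) auto
  then have "\<alpha> \<in> rat_adjoin \<gamma>" by (simp add: \<gamma>_def)
  then show ?thesis using that alg \<beta>L by blast
qed

corollary primitive_element_finite:
  fixes S :: "'a::{alg_closed_field, field_char_0} set"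
  assumes "finite S" "\<And>x. x \<in> S \<Longrightarrow> algebraic x"
  obtains \<gamma> where "algebraic \<gamma>" "S \<subseteq> rat_adjoin \<gamma>"
proof -
  have "\<exists>\<gamma>. algebraic \<gamma> \<and> S \<subseteq> rat_adjoin \<gamma>"
    using assms
  proof (induction S)
    case empty
    have "algebraic (0::'a)" by auto
    then show ?case by auto
  next
    case (insert x S)
    then obtain \<gamma> where \<gamma>: "algebraic \<gamma>" "S \<subseteq> rat_adjoin \<gamma>" by auto
    obtain \<delta> where "algebraic \<delta>" "x \<in> rat_adjoin \<delta>" "\<gamma> \<in> rat_adjoin \<delta>"
      using primitive_element[of x \<gamma>] insert.prems \<gamma>(1) by auto
    then show ?case using rat_adjoin_mono \<gamma>(2) by (intro exI[of _ \<delta>]) blast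
  qed
  then show ?thesis using that by blast
qed

section \<open>Complex embeddings\<close>

text \<open>The interface of the height argument: homomorphisms from a field \<open>K\<close> whose
  product is a rational integer at every algebraic integer. The maps are total on the type, but
  constrained on \<open>K\<close> only.\<close>

locale number_embeddings =
  fixes K :: "'b::field_char_0 set" and d :: nat and \<sigma> :: "nat \<Rightarrow> 'b \<Rightarrow> complex"
  assumes one_closed: "1 \<in> K"
    and add_closed: "x \<in> K \<Longrightarrow> y \<in> K \<Longrightarrow> x + y \<in> K"
    and mult_closed: "x \<in> K \<Longrightarrow> y \<in> K \<Longrightarrow> x * y \<in> K"
    and minus_closed: "x \<in> K \<Longrightarrow> - x \<in> K"
    and inverse_closed: "x \<in> K \<Longrightarrow> inverse x \<in> K"
    and degree_pos: "d > 0"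
    and hom_one: "i < d \<Longrightarrow> \<sigma> i 1 = 1"
    and hom_add: "i < d \<Longrightarrow> x \<in> K \<Longrightarrow> y \<in> K \<Longrightarrow> \<sigma> i (x + y) = \<sigma> i x + \<sigma> i y"
    and hom_mult: "i < d \<Longrightarrow> x \<in> K \<Longrightarrow> y \<in> K \<Longrightarrow> \<sigma> i (x * y) = \<sigma> i x * \<sigma> i y"
    and norm_int: "x \<in> K \<Longrightarrow> algebraic_int x \<Longrightarrow> (\<Prod>i<d. \<sigma> i x) \<in> \<int>"

section \<open>Construction of the embeddings of \<rat>(\<theta>)\<close>

lemma rpoly_pcompose: "rpoly (f \<circ>\<^sub>p q) x = rpoly f (rpoly q x)"
proof (induction f)
  case (pCons a f)
  have "rpoly (pCons a f) y = of_rat a + y * rpoly f y" for y :: 'a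
    using pCons.hyps by (simp add: rpoly_def map_poly_pCons)
  then show ?case using pCons.IH by (simp add: pcompose_pCons)
qed simp

lemma rpoly_of_int_poly: "rpoly (map_poly of_int f) x = poly (map_poly of_int f) x"
  by (simp add: rpoly_def map_poly_map_poly o_def)

lemma det_diagonal:
  "det (mat n n (\<lambda>(i, j). if i = j then f i else 0)) = (\<Prod>i<n. f i :: 'a::idom)"
proof -
  let ?D = "mat n n (\<lambda>(i, j). if i = j then f i else 0)"
  have "det ?D = prod_list (diag_mat ?D)"
    by (rule det_upper_triangular) (auto simp: upper_triangular_def)
  also have "diag_mat ?D = map f [0..<n]" by (auto simp: diag_mat_def)
  finally show ?thesis by (simp add: prod.list_conv_set_nth atLeast0LessThan)
qed

text \<open>A nonzero kernel vector would be the coefficient vector of a nonzero polynomial of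
  degree below \<open>n\<close> with \<open>n\<close> distinct roots.\<close>

lemma det_vandermonde_nonzero:
  fixes r :: "nat \<Rightarrow> 'a::field"
  assumes "inj_on r {..<n}"
  shows "det (mat n n (\<lambda>(i, j). r i ^ j)) \<noteq> 0"
proof
  let ?V = "mat n n (\<lambda>(i, j). r i ^ j)"
  have V: "?V \<in> carrier_mat n n" by simp
  assume "det ?V = 0"
  then obtain v where v: "v \<in> carrier_vec n" "v \<noteq> 0\<^sub>v n" "?V *\<^sub>v v = 0\<^sub>v n"
    using det_0_iff_vec_prod_zero_field[OF V] by auto
  define q where "q = (\<Sum>j<n. monom (v $ j) j)"
  have cq: "coeff q k = (if k < n then v $ k else 0)" for k
    by (simp add: q_def coeff_sum coeff_monom)
  have "n > 0" using v by (cases n) auto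
  then have deg: "degree q < n" using cq by (metis coeff_eq_0 degree_0 leading_coeff_0_iff not_less_iff_gr_or_eq)
  have "poly q (r i) = 0" if "i < n" for i
  proof -
    have "(?V *\<^sub>v v) $ i = (\<Sum>j<n. r i ^ j * v $ j)"
      using that v(1) by (simp add: scalar_prod_def atLeast0LessThan)
    then show ?thesis using v(3) that by (simp add: q_def poly_sum poly_monom mult.commute)
  qed
  then have "q = 0"
    using deg \<open>n > 0\<close>
    by (intro poly_eqI_degree[of "r ` {..<n}"]) (auto simp: card_image[OF assms])
  then have "v = 0\<^sub>v n" using cq v(1) by (intro eq_vecI) (auto, metis coeff_0)
  then show False using v(2) by simp
qed

text \<open>The embeddings send \<open>\<theta>\<close> to the complex roots of its minimal
  polynomial. The norm is the determinant of a rational matrix, and for algebraic integers it is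
  itself an algebraic integer, hence an integer.\<close>

lemma rat_adjoin_embeddings:
  fixes \<theta> :: "'a::field_char_0"
  assumes alg: "algebraic \<theta>"
  obtains d \<sigma> where "number_embeddings (rat_adjoin \<theta>) d \<sigma>"
proof -
  obtain p where p: "irreducible p" "\<And>q. rpoly q \<theta> = 0 \<longleftrightarrow> p dvd q"
    using minimal_polynomial[OF alg] by blast
  define d where "d = degree p"
  have p0: "p \<noteq> 0" using p(1) by (auto simp: irreducible_def)
  have d: "d > 0" using p(1) p0 by (metis d_def irreducible_def is_unit_iff_degree neq0_conv)
  define P :: "complex poly" where "P = map_poly of_rat p"
  have P: "poly P z = rpoly p z" "poly (pderiv P) z = rpoly (pderiv p) z" for z
    by (simp_all add: P_def rpoly_def of_rat_hom.map_poly_pderiv)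
  have degP: "degree P = d" by (simp add: P_def d_def)
  then have P0: "P \<noteq> 0" using d by auto
  have "rsquarefree P"
    unfolding rsquarefree_roots P using irreducible_simple_roots[OF p(1)] by auto
  then have card: "card {z. poly P z = 0} = d"
    using rsquarefree_card_degree[OF P0] degP by simp
  then obtain r where r: "bij_betw r {..<d} {z. poly P z = 0}"
    using ex_bij_betw_nat_finite[of "{z. poly P z = 0}"] poly_roots_finite[OF P0] by (auto simp: atLeast0LessThan)
  have root: "rpoly p (r i) = 0" if "i < d" for i
    using r that P by (auto simp: bij_betw_def)
  \<comment> \<open>Two polynomials representing \<open>x\<close> differ by a multiple of
    \<open>p\<close>, so the choice does not affect the value at a root of \<open>p\<close>.\<close>
  define \<sigma> where "\<sigma> = (\<lambda>i x. rpoly (SOME q. rpoly q \<theta> = x) (r i))"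
  have \<sigma>: "\<sigma> i (rpoly q \<theta>) = rpoly q (r i)" if "i < d" for i q
  proof -
    have "rpoly (SOME q'. rpoly q' \<theta> = rpoly q \<theta>) \<theta> = rpoly q \<theta>" by (rule someI) (rule refl)
    then have "rpoly ((SOME q'. rpoly q' \<theta> = rpoly q \<theta>) - q) \<theta> = 0" by simp
    then obtain k where k: "(SOME q'. rpoly q' \<theta> = rpoly q \<theta>) - q = p * k" using p(2) by blast
    have "rpoly ((SOME q'. rpoly q' \<theta> = rpoly q \<theta>) - q) (r i) = 0" unfolding k using root[OF that] by simp
    then show ?thesis by (simp add: \<sigma>_def)
  qed
  have "number_embeddings (rat_adjoin \<theta>) d \<sigma>"
  proof
    show "x + y \<in> rat_adjoin \<theta>" if "x \<in> rat_adjoin \<theta>" "y \<in> rat_adjoin \<theta>" for x y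
      using that by (rule rat_adjoin_add)
    show "x * y \<in> rat_adjoin \<theta>" if "x \<in> rat_adjoin \<theta>" "y \<in> rat_adjoin \<theta>" for x y
      using that by (rule rat_adjoin_mult)
    show "- x \<in> rat_adjoin \<theta>" if "x \<in> rat_adjoin \<theta>" for x
      using that by (rule rat_adjoin_minus)
    show "inverse x \<in> rat_adjoin \<theta>" if "x \<in> rat_adjoin \<theta>" for x
      using alg that by (rule rat_adjoin_inverse)
    show "\<sigma> i 1 = 1" if "i < d" for i using \<sigma>[OF that, of 1] by simp
    show "\<sigma> i (x + y) = \<sigma> i x + \<sigma> i y" if i: "i < d" and xy: "x \<in> rat_adjoin \<theta>" "y \<in> rat_adjoin \<theta>" for i x y
    proof -
      obtain f g where "x = rpoly f \<theta>" "y = rpoly g \<theta>" using xy unfolding rat_adjoin_def by blast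
      then show ?thesis using \<sigma>[OF i, of "f + g"] \<sigma>[OF i, of f] \<sigma>[OF i, of g] by simp
    qed
    show "\<sigma> i (x * y) = \<sigma> i x * \<sigma> i y" if i: "i < d" and xy: "x \<in> rat_adjoin \<theta>" "y \<in> rat_adjoin \<theta>" for i x y
    proof -
      obtain f g where "x = rpoly f \<theta>" "y = rpoly g \<theta>" using xy unfolding rat_adjoin_def by blast
      then show ?thesis using \<sigma>[OF i, of "f * g"] \<sigma>[OF i, of f] \<sigma>[OF i, of g] by simp
    qed
    show "(\<Prod>i<d. \<sigma> i x) \<in> \<int>" if x: "x \<in> rat_adjoin \<theta>" "algebraic_int x" for x
    proof (rule rational_algebraic_int_is_int)
      obtain q where q: "x = rpoly q \<theta>" using x(1) unfolding rat_adjoin_def by blast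
      obtain f where f: "poly (map_poly of_int f) x = 0" "lead_coeff f = 1"
        using x(2) unfolding algebraic_int_altdef_ipoly by auto
      \<comment> \<open>A conjugate satisfies the same monic integral equation as
        \<open>x\<close>.\<close>
      have "algebraic_int (\<sigma> i x)" if "i < d" for i
      proof -
        have "rpoly (map_poly of_int f \<circ>\<^sub>p q) \<theta> = 0"
          using f(1) by (simp add: rpoly_pcompose rpoly_of_int_poly q)
        from \<sigma>[OF that, of "map_poly of_int f \<circ>\<^sub>p q", unfolded this] \<sigma>[OF that, of 0]
        have "poly (map_poly of_int f) (\<sigma> i x) = 0"
          using \<sigma>[OF that, of q] by (simp add: rpoly_pcompose rpoly_of_int_poly q)
        then show ?thesis unfolding algebraic_int_altdef_ipoly using f(2) by auto
      qed
      then show "algebraic_int (\<Prod>i<d. \<sigma> i x)" by (intro algebraic_int_prod) auto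
      \<comment> \<open>\<open>M\<close> is the matrix of multiplication by \<open>x\<close> in the
        basis of powers of \<open>\<theta>\<close>; the Vandermonde matrix \<open>V\<close> of the
        roots diagonalises it to \<open>D\<close>.\<close>
      define M where "M = mat d d (\<lambda>(k, j). coeff ((q * monom 1 j) mod p) k)"
      define V where "V = mat d d (\<lambda>(i, j). r i ^ j)"
      define D where "D = mat d d (\<lambda>(i, j). if i = j then \<sigma> i x else 0)"
      have car: "M \<in> carrier_mat d d" "V \<in> carrier_mat d d" "D \<in> carrier_mat d d"
        "map_mat of_rat M \<in> carrier_mat d d"
        by (simp_all add: M_def V_def D_def)
      have "V * map_mat of_rat M = D * V"
      proof (rule eq_matI)
        fix i j assume "i < dim_row (D * V)" "j < dim_col (D * V)"
        then have ij: "i < d" "j < d" by (auto simp: D_def V_def)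
        define m where "m = (q * monom 1 j) mod p"
        have deg: "degree m < d"
          using degree_mod_less[OF p0, of "q * monom 1 j"] d by (auto simp: m_def d_def)
        have "(V * map_mat of_rat M) $$ (i, j) = (\<Sum>k<d. r i ^ k * of_rat (coeff m k))"
          using ij by (simp add: V_def M_def m_def scalar_prod_def atLeast0LessThan)
        also have "\<dots> = rpoly m (r i)"
          unfolding rpoly_altdef using deg
          by (intro sum.mono_neutral_cong_right) (auto simp: coeff_eq_0 mult.commute)
        also have "\<dots> = rpoly ((q * monom 1 j) div p * p + m) (r i)"
          unfolding rpoly_add rpoly_mult root[OF ij(1)] by simp
        also have "\<dots> = \<sigma> i x * r i ^ j"
          unfolding m_def div_mult_mod_eq using \<sigma>[OF ij(1), of q] by (simp add: q)
        also have "\<dots> = (\<Sum>k<d. (if i = k then \<sigma> i x else 0) * r k ^ j)"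
          using ij by (simp add: if_distrib[of "\<lambda>c. c * _"] cong: if_cong)
        also have "\<dots> = (D * V) $$ (i, j)"
          using ij by (simp add: V_def D_def scalar_prod_def atLeast0LessThan)
        finally show "(V * map_mat of_rat M) $$ (i, j) = (D * V) $$ (i, j)" .
      qed (auto simp: V_def M_def D_def)
      then have "det V * det (map_mat of_rat M) = det D * det V"
        using det_mult[OF car(2,4)] det_mult[OF car(3,2)] by metis
      moreover have "det V \<noteq> 0"
        unfolding V_def using r by (intro det_vandermonde_nonzero) (auto simp: bij_betw_def)
      ultimately have "det D = det (map_mat of_rat M)" by (metis mult.commute mult_left_cancel)
      then have "(\<Prod>i<d. \<sigma> i x) = of_rat (det M)" by (simp add: D_def det_diagonal of_rat_hom.hom_det)
      then show "(\<Prod>i<d. \<sigma> i x) \<in> \<rat>" by simp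
    qed
  qed (auto simp: d)
  then show ?thesis using that by blast
qed

section \<open>Integral relations from residues\<close>

text \<open>\<open>pole_residue a b c p l m n\<close> is the residue at \<open>p\<close> of \<open>1 / ((t - a)^l (t - b)^m (t - c)^n)\<close>.\<close>

definition pole_residue :: "'a::field \<Rightarrow> 'a \<Rightarrow> 'a \<Rightarrow> 'a \<Rightarrow> nat \<Rightarrow> nat \<Rightarrow> nat \<Rightarrow> 'a" where
  "pole_residue a b c p l m n = fls_residue (inverse
     ((fls_X + fls_const (p - a)) ^ l * (fls_X + fls_const (p - b)) ^ m * (fls_X + fls_const (p - c)) ^ n))"

section \<open>Recursions and relations for the residues\<close>

lemma fls_X_plus_const_nonzero [simp]: "fls_X + fls_const (c::'a::field) \<noteq> 0"
proof
  assume "fls_X + fls_const c = 0"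
  then have "fls_nth (fls_X + fls_const c) 1 = 0" by simp
  then show False by simp
qed

lemma pole_residue_swap12: "pole_residue a b c p l m n = pole_residue b a c p m l n"
  by (simp add: pole_residue_def mult_ac)

lemma pole_residue_swap23: "pole_residue a b c p l m n = pole_residue a c b p l n m"
  by (simp add: pole_residue_def mult_ac)

lemma pole_residue_swap13: "pole_residue a b c p l m n = pole_residue c b a p n m l"
  by (simp add: pole_residue_def mult_ac)

lemma inverse_mult_diff_powers:
  fixes A B C :: "'a::field"
  assumes "A \<noteq> 0" "B \<noteq> 0" "C \<noteq> 0"
  shows "(B - A) * inverse (A ^ Suc l * B ^ Suc m * C ^ n)
     = inverse (A ^ Suc l * B ^ m * C ^ n) - inverse (A ^ l * B ^ Suc m * C ^ n)"
proof -
  have "(B - A) * inverse (A ^ Suc l * B ^ Suc m * C ^ n)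
     = (B * inverse B) * inverse (A ^ Suc l * B ^ m * C ^ n) - (A * inverse A) * inverse (A ^ l * B ^ Suc m * C ^ n)"
    unfolding power_Suc inverse_mult_distrib by (simp only: algebra_simps)
  then show ?thesis using assms by simp
qed

text \<open>Partial fractions: \<open>a - b\<close> is the difference of \<open>t - b\<close> and
  \<open>t - a\<close>, and each of the two terms cancels one factor of the denominator.\<close>

lemma pole_residue_rec:
  "(a - b) * pole_residue a b c p (Suc l) (Suc m) n
     = pole_residue a b c p (Suc l) m n - pole_residue a b c p l (Suc m) n"
proof -
  let ?A = "fls_X + fls_const (p - a)" and ?B = "fls_X + fls_const (p - b)" and ?C = "fls_X + fls_const (p - c)"
  have ab: "fls_const (a - b) = ?B - ?A" by (simp add: fls_minus_const)
  have "fls_const (a - b) * inverse (?A ^ Suc l * ?B ^ Suc m * ?C ^ n)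
     = inverse (?A ^ Suc l * ?B ^ m * ?C ^ n) - inverse (?A ^ l * ?B ^ Suc m * ?C ^ n)"
    unfolding ab by (rule inverse_mult_diff_powers) auto
  from arg_cong[OF this, of fls_residue] show ?thesis
    by (simp add: pole_residue_def fls_residue_fls_const_times del: power_Suc)
qed

lemma pole_residue_rec13:
  "(a - c) * pole_residue a b c p (Suc l) m (Suc n)
     = pole_residue a b c p (Suc l) m n - pole_residue a b c p l m (Suc n)"
  using pole_residue_rec[of a c b p l n m] by (simp add: pole_residue_swap23[of a c b])

lemma pole_residue_rec23:
  "(b - c) * pole_residue a b c p l (Suc m) (Suc n)
     = pole_residue a b c p l (Suc m) n - pole_residue a b c p l m (Suc n)"
  using pole_residue_rec13[of b c a p m l n] by (simp add: pole_residue_swap12[of b a c])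

lemma pole_residue_no_pole:
  assumes "p \<noteq> b" "p \<noteq> c"
  shows "pole_residue a b c p 0 m n = 0"
proof -
  have sd: "fls_subdegree (fls_X + fls_const (p - q)) = 0" if "p \<noteq> q" for q
    by (rule fls_subdegree_eqI) (use that in auto)
  have "fls_subdegree (inverse ((fls_X + fls_const (p - b)) ^ m * (fls_X + fls_const (p - c)) ^ n)) = 0"
    using assms by (simp add: fls_subdegree_pow sd fls_inverse_subdegree)
  then show ?thesis
    unfolding pole_residue_def by (simp add: fls_residue_power_series del: fls_residue_def)
qed

lemma pole_residue_single: "pole_residue a b c a l 0 0 = (if l = 1 then 1 else 0)"
proof -
  have "inverse (fls_X ^ l :: 'a fls) = fls_X_intpow (- int l)"
    by (simp only: fls_inverse_X_power fls_X_inv_power_conv_shift_1) simp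
  then show ?thesis by (simp add: pole_residue_def)
qed

text \<open>A derivative has residue 0. This is applied to the derivative of 1 / ((t - a)^(l+1) (t -
  b)^m (t - c)^n). The coefficients do not depend on \<open>p\<close>, so residues at different
  poles obey the same recursion.\<close>

lemma pole_residue_contiguous:
  fixes a b c p :: "'a::field_char_0"
  shows "of_nat (l + m + n + 1) * pole_residue a b c p l (Suc m) (Suc n)
    + (of_nat (l + m + 1) * (a - c) + of_nat (l + n + 1) * (a - b)) * pole_residue a b c p (Suc l) (Suc m) (Suc n)
    + of_nat (l + 1) * ((a - b) * (a - c)) * pole_residue a b c p (Suc (Suc l)) (Suc m) (Suc n) = 0"
proof -
  define A where "A = fls_X + fls_const (p - a)"
  define u where "u = fls_const (a - b)"
  define v where "v = fls_const (a - c)"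
  have B: "fls_X + fls_const (p - b) = A + u" by (simp add: A_def u_def fls_plus_const)
  have C: "fls_X + fls_const (p - c) = A + v" by (simp add: A_def v_def fls_plus_const)
  have nz: "A \<noteq> 0" "A + u \<noteq> 0" "A + v \<noteq> 0"
    unfolding B[symmetric] C[symmetric] unfolding A_def by (rule fls_X_plus_const_nonzero)+
  define P where "P = A ^ Suc l * (A + u) ^ m * (A + v) ^ n"
  have P0: "P \<noteq> 0" using nz by (simp add: P_def)
  have dA: "fls_deriv A = 1" "fls_deriv (A + u) = 1" "fls_deriv (A + v) = 1"
    by (simp_all add: A_def u_def v_def)
  have "fls_deriv (inverse P) * P + inverse P * fls_deriv P = 0"
  proof -
    have "fls_deriv (inverse P * P) = 0" using P0 by simp
    then show ?thesis unfolding fls_deriv_mult by (simp add: add.commute)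
  qed
  then have d: "fls_deriv (inverse P) = - inverse P * fls_deriv P * inverse P"
  proof -
    have "fls_deriv (inverse P) = (fls_deriv (inverse P) * P) * inverse P" using P0 by simp
    also have "fls_deriv (inverse P) * P = - (inverse P * fls_deriv P)"
      using \<open>fls_deriv (inverse P) * P + _ = 0\<close> by (simp add: eq_neg_iff_add_eq_0)
    finally show ?thesis by simp
  qed
  \<comment> \<open>Multiplied by \<open>g\<close>, so that the exponent \<open>k - 1\<close> does
    not occur.\<close>
  have dpow: "fls_deriv (g ^ k) * g = of_nat k * g ^ k" if "fls_deriv g = 1" for g :: "'a fls" and k
    by (induction k) (auto simp: that algebra_simps)
  have dP: "fls_deriv P * (A * (A + u) * (A + v)) = P * (of_nat (Suc l) * ((A + u) * (A + v))
     + of_nat m * (A * (A + v)) + of_nat n * (A * (A + u)))"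
  proof -
    have "fls_deriv P * (A * (A + u) * (A + v)) =
      (fls_deriv (A ^ Suc l) * A) * (A + u) ^ m * (A + v) ^ n * ((A + u) * (A + v))
      + A ^ Suc l * (fls_deriv ((A + u) ^ m) * (A + u)) * (A + v) ^ n * (A * (A + v))
      + A ^ Suc l * (A + u) ^ m * (fls_deriv ((A + v) ^ n) * (A + v)) * (A * (A + u))"
      unfolding P_def fls_deriv_mult by (simp only: algebra_simps)
    then show ?thesis unfolding dpow[OF dA(1)] dpow[OF dA(2)] dpow[OF dA(3)]
      by (simp only: P_def algebra_simps)
  qed
  let ?I = "\<lambda>k. inverse (A ^ k * (A + u) ^ Suc m * (A + v) ^ Suc n)"
  define W where "W = A * (A + u) * (A + v)"
  have W: "W * inverse W = 1" by (rule right_inverse) (use nz in \<open>simp add: W_def\<close>)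
  have "fls_deriv (inverse P) = - inverse P * fls_deriv P * inverse P * (W * inverse W)"
    unfolding W d by simp
  also have "\<dots> = - inverse P * (fls_deriv P * W) * inverse P * inverse W"
    by (simp only: mult_ac)
  also have "\<dots> = - (of_nat (Suc l) * ((A + u) * (A + v))
     + of_nat m * (A * (A + v)) + of_nat n * (A * (A + u))) * inverse (P * (A * (A + u) * (A + v)))"
  proof -
    have *: "- inverse P * (fls_deriv P * W) * inverse P * inverse W = - S * inverse (P * W)"
      if "fls_deriv P * W = P * S" for S
    proof -
      have "- inverse P * (P * S) * inverse P * inverse W = - S * inverse (P * W) * (P * inverse P)"
        unfolding inverse_mult_distrib by (simp only: mult_minus_left mult_minus_right mult_ac)
      also have "P * inverse P = 1" using P0 by (rule right_inverse)
      finally show ?thesis unfolding that by simp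
    qed
    show ?thesis using *[OF dP[folded W_def]] unfolding W_def .
  qed
  also have "P * (A * (A + u) * (A + v)) = A ^ Suc (Suc l) * (A + u) ^ Suc m * (A + v) ^ Suc n"
    by (simp add: P_def)
  \<comment> \<open>Expansion in powers of \<open>A\<close>: against the exponent
    \<open>l + 2\<close> in the denominator, the three terms leave the exponents \<open>l\<close>,
    \<open>l + 1\<close> and \<open>l + 2\<close>.\<close>
  also have "of_nat (Suc l) * ((A + u) * (A + v)) + of_nat m * (A * (A + v)) + of_nat n * (A * (A + u))
     = of_nat (l + m + n + 1) * A ^ 2 + (of_nat (l + m + 1) * v + of_nat (l + n + 1) * u) * A + of_nat (l + 1) * (u * v)"
    by (simp add: algebra_simps power2_eq_square)
  also have "- (of_nat (l + m + n + 1) * A ^ 2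
      + (of_nat (l + m + 1) * v + of_nat (l + n + 1) * u) * A + of_nat (l + 1) * (u * v)) * ?I (Suc (Suc l))
     = - (of_nat (l + m + n + 1) * (A ^ 2 * ?I (Suc (Suc l)))
      + (of_nat (l + m + 1) * v + of_nat (l + n + 1) * u) * (A * ?I (Suc (Suc l)))
      + of_nat (l + 1) * (u * v) * ?I (Suc (Suc l)))"
    by (simp only: minus_mult_left[symmetric] neg_equal_iff_equal distrib_right mult.assoc)
  also have "A ^ 2 * ?I (Suc (Suc l)) = ?I l"
  proof -
    have "A ^ 2 * ?I (Suc (Suc l)) = (A * inverse A) * ((A * inverse A) * ?I l)"
      unfolding power2_eq_square power_Suc inverse_mult_distrib by (simp only: mult_ac)
    then show ?thesis using nz by simp
  qed
  also have "A * ?I (Suc (Suc l)) = ?I (Suc l)"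
  proof -
    have "A * ?I (Suc (Suc l)) = (A * inverse A) * ?I (Suc l)"
      unfolding power_Suc inverse_mult_distrib by (simp only: mult_ac)
    then show ?thesis using nz by simp
  qed
  finally have E: "fls_deriv (inverse P) = - (of_nat (l + m + n + 1) * ?I l
      + (of_nat (l + m + 1) * v + of_nat (l + n + 1) * u) * ?I (Suc l)
      + of_nat (l + 1) * (u * v) * ?I (Suc (Suc l)))" .
  have R: "pole_residue a b c p k (Suc m) (Suc n) = fls_residue (?I k)" for k
    unfolding pole_residue_def B C A_def[symmetric] ..
  have co: "of_nat (l + m + n + 1) = (fls_const (of_nat (l + m + n + 1)) :: 'a fls)"
    "of_nat (l + m + 1) * v + of_nat (l + n + 1) * u = fls_const (of_nat (l + m + 1) * (a - c) + of_nat (l + n + 1) * (a - b))"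
    "of_nat (l + 1) * (u * v) = fls_const (of_nat (l + 1) * ((a - b) * (a - c)))"
    by (simp_all only: u_def v_def fls_of_nat fls_plus_const fls_const_mult_const)
  have "fls_residue (fls_deriv (inverse P)) = 0" by (rule fls_residue_deriv)
  then have "fls_residue (of_nat (l + m + n + 1) * ?I l
      + (of_nat (l + m + 1) * v + of_nat (l + n + 1) * u) * ?I (Suc l)
      + of_nat (l + 1) * (u * v) * ?I (Suc (Suc l))) = 0"
    unfolding E fls_residue_def fls_uminus_nth neg_equal_0_iff_equal .
  then show ?thesis
    unfolding R co fls_residue_add fls_residue_fls_const_times .
qed

text \<open>The residue theorem on the projective line, where infinity contributes only for total
  order 1. Partial fractions lower the total order until a single pole remains.\<close>

lemma sum_pole_residue:
  assumes "a \<noteq> b" "a \<noteq> c" "b \<noteq> c" "l + m + n > 0"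
  shows "pole_residue a b c a l m n + pole_residue a b c b l m n + pole_residue a b c c l m n
    = (if l + m + n = 1 then 1 else 0)"
  using assms(4)
proof (induction "l + m + n" arbitrary: l m n rule: less_induct)
  case less
  let ?S = "\<lambda>l m n. pole_residue a b c a l m n + pole_residue a b c b l m n + pole_residue a b c c l m n"
  have ab: "(a - b) * ?S (Suc l) (Suc m) n = ?S (Suc l) m n - ?S l (Suc m) n" for l m n
    using pole_residue_rec[of a b c _ l m n] by (simp add: distrib_left)
  have ac: "(a - c) * ?S (Suc l) m (Suc n) = ?S (Suc l) m n - ?S l m (Suc n)" for l m n
    using pole_residue_rec13[of a c b _ l m n] by (simp add: distrib_left)
  have bc: "(b - c) * ?S l (Suc m) (Suc n) = ?S l (Suc m) n - ?S l m (Suc n)" for l m n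
    using pole_residue_rec23[of b c a _ l m n] by (simp add: distrib_left)
  consider l' m' where "l = Suc l'" "m = Suc m'" | l' n' where "l = Suc l'" "n = Suc n'"
    | m' n' where "m = Suc m'" "n = Suc n'" | "m = 0" "n = 0" | "l = 0" "n = 0" | "l = 0" "m = 0"
    by (cases l; cases m; cases n) auto
  then show ?case
  proof cases
    case 1
    have "?S (Suc l') m' n = ?S l' (Suc m') n"
      using less.hyps[of "Suc l'" m' n] less.hyps[of l' "Suc m'" n] 1 by simp
    then show ?thesis using ab[of l' m' n] 1 assms by simp
  next
    case 2
    have "?S (Suc l') m n' = ?S l' m (Suc n')"
      using less.hyps[of "Suc l'" m n'] less.hyps[of l' m "Suc n'"] 2 by simp
    then show ?thesis using ac[of l' m n'] 2 assms by simp
  next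
    case 3
    have "?S l (Suc m') n' = ?S l m' (Suc n')"
      using less.hyps[of l "Suc m'" n'] less.hyps[of l m' "Suc n'"] 3 by simp
    then show ?thesis using bc[of l m' n'] 3 assms by simp
  next
    case 4
    then show ?thesis
      using assms pole_residue_no_pole[of b a c b l 0] pole_residue_no_pole[of c b a c 0 l]
        pole_residue_swap12[of a b c b l 0 0] pole_residue_swap13[of a b c c l 0 0]
      by (auto simp: pole_residue_single)
  next
    case 5
    then show ?thesis
      using assms pole_residue_no_pole[of a b c a m 0] pole_residue_no_pole[of c b a c m 0]
        pole_residue_swap12[of a b c b 0 m 0] pole_residue_swap13[of a b c c 0 m 0]
      by (auto simp: pole_residue_single)
  next
    case 6
    then show ?thesis
      using assms pole_residue_no_pole[of a b c a 0 n] pole_residue_no_pole[of b a c b 0 n]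
        pole_residue_swap12[of a b c b 0 0 n] pole_residue_swap13[of a b c c 0 0 n]
      by (auto simp: pole_residue_single)
  qed
qed

text \<open>The residues with their denominators cleared; the recursion is \<open>pole_residue_rec\<close>.\<close>

fun pade :: "nat \<Rightarrow> nat \<Rightarrow> nat \<Rightarrow> 'a::comm_ring_1 \<Rightarrow> 'a \<Rightarrow> 'a" where
  "pade 0 m n u v = 0"
| "pade (Suc l) (Suc m) n u v = pade (Suc l) m n u v - v * pade l (Suc m) n u v"
| "pade (Suc l) 0 (Suc n) u v = pade (Suc l) 0 n u v - u * pade l 0 (Suc n) u v"
| "pade (Suc 0) 0 0 u v = 1"
| "pade (Suc (Suc l)) 0 0 u v = 0"

text \<open>The residue is the coefficient of (t - a)^l in the expansion of 1 / ((t - b)^m (t -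
  c)^n) at \<open>a\<close>, whose denominators divide the stated powers.\<close>

lemma pole_residue_eq_pade:
  assumes "a \<noteq> b" "a \<noteq> c"
  shows "pole_residue a b c a (Suc l) m n * (a - b) ^ (l + m) * (a - c) ^ (l + n)
    = pade (Suc l) m n (a - b) (a - c)"
proof (induction "Suc l" m n "a - b" "a - c" arbitrary: l rule: pade.induct)
  case (2 l m n)
  have "pole_residue a b c a (Suc l) (Suc m) n * (a - b) ^ (l + Suc m) * (a - c) ^ (l + n)
     = ((a - b) * pole_residue a b c a (Suc l) (Suc m) n) * (a - b) ^ (l + m) * (a - c) ^ (l + n)"
    by simp
  also have "\<dots> = pole_residue a b c a (Suc l) m n * (a - b) ^ (l + m) * (a - c) ^ (l + n)
    - pole_residue a b c a l (Suc m) n * (a - b) ^ (l + m) * (a - c) ^ (l + n)"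
    by (subst pole_residue_rec) (simp only: left_diff_distrib)
  also have "pole_residue a b c a l (Suc m) n * (a - b) ^ (l + m) * (a - c) ^ (l + n) =
     (a - c) * pade l (Suc m) n (a - b) (a - c)"
  \<comment> \<open>For \<open>l = 0\<close> there is no pole at \<open>a\<close>, in agreement with
    the value 0 of \<open>pade 0\<close>.\<close>
  proof (cases l)
    case 0
    then show ?thesis using assms by (simp add: pole_residue_no_pole)
  next
    case (Suc l')
    show ?thesis using 2(2)[OF Suc] by (simp add: Suc mult_ac)
  qed
  finally show ?case using 2(1) by simp
next
  case (3 l n)
  have "pole_residue a b c a (Suc l) 0 (Suc n) * (a - b) ^ (l + 0) * (a - c) ^ (l + Suc n)
     = ((a - c) * pole_residue a b c a (Suc l) 0 (Suc n)) * (a - b) ^ l * (a - c) ^ (l + n)"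
    by simp
  also have "\<dots> = pole_residue a b c a (Suc l) 0 n * (a - b) ^ l * (a - c) ^ (l + n)
    - pole_residue a b c a l 0 (Suc n) * (a - b) ^ l * (a - c) ^ (l + n)"
    by (subst pole_residue_rec13) (simp only: left_diff_distrib)
  also have "pole_residue a b c a l 0 (Suc n) * (a - b) ^ l * (a - c) ^ (l + n) =
     (a - b) * pade l 0 (Suc n) (a - b) (a - c)"
  proof (cases l)
    case 0
    then show ?thesis using assms by (simp add: pole_residue_no_pole)
  next
    case (Suc l')
    show ?thesis using 3(2)[OF Suc] by (simp add: Suc mult_ac)
  qed
  finally show ?case using 3(1) by simp
qed (simp_all add: pole_residue_single)

text \<open>This closed form shows nonvanishing for \<open>u \<noteq> 0\<close> in characteristic 0,
  where the independence proof starts.\<close>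

lemma pade_0: "pade (Suc l) 0 (Suc n) u v = (- u) ^ l * of_nat ((l + n) choose l)"
proof (induction l arbitrary: n)
  case 0
  show ?case by (induction n) auto
next
  case (Suc l)
  note outer = Suc
  show ?case
  proof (induction n)
    case 0
    show ?case using outer[of 0] by simp
  next
    case (Suc n)
    have "pade (Suc (Suc l)) 0 (Suc (Suc n)) u v
       = pade (Suc (Suc l)) 0 (Suc n) u v - u * pade (Suc l) 0 (Suc (Suc n)) u v" by simp
    also have "\<dots> = (- u) ^ Suc l * of_nat ((Suc l + n) choose Suc l) + (- u) ^ Suc l * of_nat ((l + Suc n) choose l)"
      by (simp only: Suc outer) simp
    also have "\<dots> = (- u) ^ Suc l * of_nat ((Suc l + Suc n) choose Suc l)"
      by (simp add: algebra_simps)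
    finally show ?case .
  qed
qed

lemma pade_1: "pade (Suc 0) m n u v = 1"
proof (induction m)
  case 0
  show ?case by (induction n) auto
qed auto

text \<open>Each recursion step at most doubles the bound, and a factor \<open>u\<close> or
  \<open>v\<close> appears exactly when \<open>l\<close> drops, so the degree is
  \<open>l\<close>.\<close>

lemma norm_pade_le:
  fixes u v :: "'a::real_normed_field"
  assumes "norm u \<le> H" "norm v \<le> H" "1 \<le> H"
  shows "norm (pade (Suc l) m n u v) \<le> 2 ^ (l + m + n) * H ^ l"
proof (induction l arbitrary: m n)
  case 0
  show ?case by (simp add: pade_1)
next
  case (Suc l)
  have H: "0 \<le> H" using assms(3) by simp
  have step: "norm (x - w * y) \<le> 2 ^ Suc k * H ^ Suc l"
    if "norm x \<le> 2 ^ k * H ^ Suc l" "norm y \<le> 2 ^ k * H ^ l" "norm w \<le> H" for x y w :: 'a and k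
  proof -
    have "norm (x - w * y) \<le> norm x + norm w * norm y"
      by (metis norm_triangle_ineq4 norm_mult)
    also have "\<dots> \<le> 2 ^ k * H ^ Suc l + H * (2 ^ k * H ^ l)"
      using that H by (intro add_mono mult_mono) auto
    finally show ?thesis by (simp add: mult_ac)
  qed
  have base: "norm (pade (Suc (Suc l)) 0 n u v) \<le> 2 ^ (Suc l + n) * H ^ Suc l" for n
  proof (induction n)
    case 0
    then show ?case using H by simp
  next
    case (Suc n)
    show ?case using step[OF Suc, of "pade (Suc l) 0 (Suc n) u v" u] Suc.prems assms
        \<open>\<And>m n. norm (pade (Suc l) m n u v) \<le> 2 ^ (l + m + n) * H ^ l\<close>[of 0 "Suc n"] by simp
  qed
  show ?case
  proof (induction m)
    case 0
    then show ?case using base by simp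
  next
    case (Suc m)
    show ?case using step[OF Suc, of "pade (Suc l) (Suc m) n u v" v] assms
        \<open>\<And>m n. norm (pade (Suc l) m n u v) \<le> 2 ^ (l + m + n) * H ^ l\<close>[of "Suc m" n] by simp
  qed
qed

text \<open>By the three-term recursion, consecutive 2x2 determinants of residues at
  \<open>a\<close> and \<open>b\<close> are linked by
  \<open>\<gamma> * W (l + 1) = \<alpha> * W l\<close> with \<open>\<alpha> \<noteq> 0\<close>, so
  nonvanishing propagates.\<close>

lemma pole_residue_independent:
  fixes a b c :: "'a::field_char_0"
  assumes "a \<noteq> b" "a \<noteq> c" "b \<noteq> c"
  shows "pole_residue a b c a l (Suc m) (Suc n) * pole_residue a b c b (Suc l) (Suc m) (Suc n)
     \<noteq> pole_residue a b c b l (Suc m) (Suc n) * pole_residue a b c a (Suc l) (Suc m) (Suc n)"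
proof (induction l)
  case 0
  \<comment> \<open>Without a pole at \<open>a\<close> the determinant reduces, up to sign, to a
    product of two nonzero residues.\<close>
  have "pole_residue a b c a 0 (Suc m) (Suc n) = 0"
    using assms by (simp add: pole_residue_no_pole)
  moreover have "pole_residue a b c a (Suc 0) (Suc m) (Suc n) \<noteq> 0"
    using pole_residue_eq_pade[of a b c 0 "Suc m" "Suc n"] assms by (auto simp: pade_1 simp del: pade.simps)
  moreover have "pole_residue b a c b (Suc m) 0 (Suc n) \<noteq> 0"
    using pole_residue_eq_pade[of b a c m 0 "Suc n"] assms by (auto simp: pade_0 simp del: pade.simps)
  ultimately show ?case by (simp add: pole_residue_swap12[of a b c b])
next
  case (Suc l)
  let ?r = "\<lambda>p l. pole_residue a b c p l (Suc m) (Suc n)"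
  define \<alpha> :: 'a where "\<alpha> = of_nat (l + m + n + 1)"
  define \<gamma> where "\<gamma> = of_nat (l + 1) * ((a - b) * (a - c))"
  obtain \<beta> where rec: "\<And>p. \<alpha> * ?r p l + \<beta> * ?r p (Suc l) + \<gamma> * ?r p (Suc (Suc l)) = 0"
    using pole_residue_contiguous[of l m n a b c] unfolding \<alpha>_def \<gamma>_def by blast
  have "\<gamma> * (?r a (Suc l) * ?r b (Suc (Suc l)) - ?r b (Suc l) * ?r a (Suc (Suc l)))
      = \<alpha> * (?r a l * ?r b (Suc l) - ?r b l * ?r a (Suc l))"
  proof -
    have g: "\<gamma> * ?r p (Suc (Suc l)) = - (\<alpha> * ?r p l + \<beta> * ?r p (Suc l))" for p
      using rec[of p] by (metis add_eq_0_iff)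
    have "\<gamma> * (?r a (Suc l) * ?r b (Suc (Suc l)) - ?r b (Suc l) * ?r a (Suc (Suc l)))
      = ?r a (Suc l) * (\<gamma> * ?r b (Suc (Suc l))) - ?r b (Suc l) * (\<gamma> * ?r a (Suc (Suc l)))"
      by (simp only: algebra_simps)
    then show ?thesis unfolding g by (simp add: algebra_simps)
  qed
  moreover have "\<alpha> \<noteq> 0" unfolding \<alpha>_def by (simp only: of_nat_eq_0_iff)
  ultimately show ?case using Suc.IH by auto
qed

text \<open>The poles are \<open>0\<close>, \<open>1\<close> and \<open>y\<close>, with differences \<open>\<plusminus>1\<close>, \<open>\<plusminus>x\<close> and \<open>\<plusminus>y\<close>.
  The two relations \<open>j = 0\<close> and \<open>j = 1\<close> are linearly independent, so that a given vector
  is proportional to at most one of them.\<close>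

lemma pade_relation:
  fixes x y x' y' :: "'a::field_char_0" and N :: nat
  assumes xy: "x + y = 1" "x \<noteq> 0" "y \<noteq> 0" and xy': "x' + y' = 1"
  defines "n \<equiv> Suc N" and "k \<equiv> 2 * N + 1"
  obtains A B C where
    "A * x ^ k + B * y ^ k + C = 0" "A * x ^ k * y' \<noteq> B * y ^ k * x'"
    "\<exists>j\<in>{0,1}. A = pade (n + j) n n (-1) (-y) \<and> B = y ^ j * pade n (n + j) n 1 x
       \<and> C = - pade n (n + j) n y (-x)"
proof -
  define r where "r = pole_residue 0 1 y"
  have x: "x = 1 - y" using xy by (simp add: algebra_simps)
  then have y1: "y \<noteq> 1" "1 - y = x" "y - 1 = - x" using xy by auto
  have A: "r 0 (n + j) n n * y ^ (k + j) = pade (n + j) n n (-1) (-y)" for j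
  proof -
    have e: "N + j + n = k + j" "Suc (N + j) = n + j" by (simp_all add: n_def k_def)
    have "(-1) ^ (k + j) * (-y) ^ (k + j) = y ^ (k + j)"
      by (simp flip: power_mult_distrib)
    moreover have "r 0 (n + j) n n * (0 - 1) ^ (k + j) * (0 - y) ^ (k + j) = pade (n + j) n n (0 - 1) (0 - y)"
      using pole_residue_eq_pade[of 0 1 y "N + j" n n] xy unfolding e r_def by simp
    ultimately show ?thesis by (simp add: mult.assoc)
  qed
  have B: "r 1 (n + j) n n * x ^ k = pade n (n + j) n 1 x" for j
    using pole_residue_eq_pade[of 1 0 y N "n + j" n] y1 xy
    by (simp add: r_def n_def k_def pole_residue_swap12[of 0 1] mult_2 del: pade.simps)
  have C: "r y (n + j) n n * y ^ (k + j) * x ^ k = - pade n (n + j) n y (-x)" for j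
  proof -
    have e1: "r y (n + j) n n = pole_residue y 0 1 y (Suc N) (n + j) n"
      by (simp add: r_def n_def pole_residue_swap13[of 0 1] pole_residue_swap23[of y 1])
    have e2: "(- x) ^ (N + n) = - (x ^ k)" by (simp add: n_def k_def mult_2)
    have e3: "N + (n + j) = k + j" by (simp add: n_def k_def)
    have e4: "pole_residue y 0 1 y (Suc N) (n + j) n * (y - 0) ^ (N + (n + j)) * (y - 1) ^ (N + n)
        = pade (Suc N) (n + j) n (y - 0) (y - 1)"
      using xy y1 by (intro pole_residue_eq_pade) auto
    have "r y (n + j) n n * y ^ (k + j) * - (x ^ k) = pade (Suc N) (n + j) n y (- x)"
      using e4 unfolding e3 e1[symmetric] y1(3) diff_0_right e2 .
    then show ?thesis unfolding n_def[symmetric] by (metis minus_minus mult_minus_right)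
  qed
  have sum: "r 0 (n + j) n n + r 1 (n + j) n n + r y (n + j) n n = 0" for j
    using sum_pole_residue[of 0 1 y "n + j" n n] y1 xy by (auto simp: r_def n_def)
  have "r 0 n n n * r 1 (n + 1) n n \<noteq> r 1 n n n * r 0 (n + 1) n n"
    using pole_residue_independent[of 0 1 y n N N] y1 xy by (auto simp: r_def n_def)
  \<comment> \<open>If both relations were proportional to \<open>(x', y')\<close>, their
    determinant would be killed by \<open>x'\<close> and by \<open>y'\<close>, hence by
    \<open>x' + y' = 1\<close>.\<close>
  then obtain j :: nat where j: "j \<in> {0,1}" "r 0 (n + j) n n * y' \<noteq> r 1 (n + j) n n * x'"
  proof (cases "r 0 (n + 0) n n * y' = r 1 (n + 0) n n * x' \<and> r 0 (n + 1) n n * y' = r 1 (n + 1) n n * x'")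
    case True
    have "p * s * t = q * w * t" if "p * t' = q * t" "w * t' = s * t" for p q s w t t' :: 'a
      using that by (metis mult.assoc mult.left_commute)
    moreover have "p * s * t' = q * w * t'" if "p * t' = q * t" "w * t' = s * t" for p q s w t t' :: 'a
      using that by (metis mult.assoc mult.left_commute)
    ultimately have "r 0 n n n * r 1 (n + 1) n n * x' = r 1 n n n * r 0 (n + 1) n n * x'"
      "r 0 n n n * r 1 (n + 1) n n * y' = r 1 n n n * r 0 (n + 1) n n * y'"
      using True unfolding add_0_right by blast+
    then show ?thesis using \<open>r 0 n n n * r 1 (n + 1) n n \<noteq> _\<close> xy' by auto
  next
    case False
    then show ?thesis using that[of 0] that[of 1] by blast
  qed
  \<comment> \<open>Multiplication by \<open>S\<close> turns the three residues into
    \<open>A * x ^ k\<close>, \<open>B * y ^ k\<close> and \<open>C\<close>.\<close>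
  define S where "S = y ^ (k + j) * x ^ k"
  have S: "S \<noteq> 0" using xy by (simp add: S_def)
  show ?thesis
  proof (rule that)
    let ?A = "pade (n + j) n n (-1) (-y)" and ?B = "y ^ j * pade n (n + j) n 1 x"
      and ?C = "- pade n (n + j) n y (-x)"
    have A': "?A * x ^ k = S * r 0 (n + j) n n" by (simp add: S_def flip: A)
    have B': "?B * y ^ k = S * r 1 (n + j) n n" by (simp add: S_def power_add flip: B)
    have C': "?C = S * r y (n + j) n n" by (simp add: S_def flip: C)
    show "?A * x ^ k + ?B * y ^ k + ?C = 0"
      unfolding A' B' C' using sum[of j] by (metis distrib_left mult_zero_right)
    show "?A * x ^ k * y' \<noteq> ?B * y ^ k * x'"
      unfolding A' B' using S j(2) by (simp add: mult.assoc)
    show "\<exists>j\<in>{0,1}. ?A = pade (n + j) n n (-1) (-y) \<and> ?B = y ^ j * pade n (n + j) n 1 x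
       \<and> ?C = - pade n (n + j) n y (-x)" using j(1) by blast
  qed
qed

section \<open>The unit equation\<close>

context number_embeddings
begin

section \<open>Field operations under the embeddings\<close>

lemma zero_closed: "0 \<in> K"
  using add_closed[OF one_closed minus_closed[OF one_closed]] by simp

lemma diff_closed: "x \<in> K \<Longrightarrow> y \<in> K \<Longrightarrow> x - y \<in> K"
  using add_closed[of x "- y"] minus_closed[of y] by simp

lemma power_closed: "x \<in> K \<Longrightarrow> x ^ k \<in> K"
  by (induction k) (auto intro: one_closed mult_closed)

lemma of_nat_closed: "of_nat k \<in> K"
  by (induction k) (auto intro: zero_closed one_closed add_closed)

lemma hom_zero: "i < d \<Longrightarrow> \<sigma> i 0 = 0"
  using hom_add[of i 0 0] zero_closed by simp

lemma hom_minus: "i < d \<Longrightarrow> x \<in> K \<Longrightarrow> \<sigma> i (- x) = - \<sigma> i x"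
  using hom_add[of i x "- x"] minus_closed hom_zero by (simp add: eq_neg_iff_add_eq_0 add.commute)

lemma hom_diff: "i < d \<Longrightarrow> x \<in> K \<Longrightarrow> y \<in> K \<Longrightarrow> \<sigma> i (x - y) = \<sigma> i x - \<sigma> i y"
  using hom_add[of i x "- y"] minus_closed hom_minus by simp

lemma hom_power: "i < d \<Longrightarrow> x \<in> K \<Longrightarrow> \<sigma> i (x ^ k) = \<sigma> i x ^ k"
  by (induction k) (auto simp: hom_one hom_mult power_closed)

lemma hom_of_nat: "i < d \<Longrightarrow> \<sigma> i (of_nat k) = of_nat k"
  by (induction k) (auto simp: hom_zero hom_one hom_add one_closed of_nat_closed)

lemma hom_nonzero: "i < d \<Longrightarrow> x \<in> K \<Longrightarrow> x \<noteq> 0 \<Longrightarrow> \<sigma> i x \<noteq> 0"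
  using hom_mult[of i x "inverse x"] inverse_closed hom_one by auto

lemma hom_inverse: "i < d \<Longrightarrow> x \<in> K \<Longrightarrow> \<sigma> i (inverse x) = inverse (\<sigma> i x)"
  using hom_mult[of i x "inverse x"] inverse_closed hom_one hom_zero
  by (cases "x = 0") (auto intro: inverse_unique[symmetric])

lemma inj_on_hom: "i < d \<Longrightarrow> inj_on (\<sigma> i) K"
  by (rule inj_onI) (metis diff_closed hom_diff hom_nonzero right_minus_eq)

lemma pade_closed: "u \<in> K \<Longrightarrow> v \<in> K \<Longrightarrow> pade l m n u v \<in> K"
  by (induction l m n u v rule: pade.induct) (auto intro: zero_closed one_closed diff_closed mult_closed)

lemma hom_pade: "i < d \<Longrightarrow> u \<in> K \<Longrightarrow> v \<in> K \<Longrightarrow> \<sigma> i (pade l m n u v) = pade l m n (\<sigma> i u) (\<sigma> i v)"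
  by (induction l m n u v rule: pade.induct)
    (auto simp: hom_zero hom_one hom_diff hom_mult pade_closed mult_closed)

lemma norm_ge_1:
  assumes "x \<in> K" "x \<noteq> 0" "algebraic_int x"
  shows "1 \<le> (\<Prod>i<d. norm (\<sigma> i x))"
proof -
  obtain z where z: "(\<Prod>i<d. \<sigma> i x) = of_int z" using norm_int[OF assms(1,3)] by (auto elim: Ints_cases)
  have "(\<Prod>i<d. \<sigma> i x) \<noteq> 0" using hom_nonzero assms by auto
  then have "z \<noteq> 0" unfolding z by auto
  moreover have "(\<Prod>i<d. norm (\<sigma> i x)) = of_int \<bar>z\<bar>"
    unfolding prod_norm z by simp
  ultimately show ?thesis by linarith
qed

lemma sum_ln_nonneg:
  assumes "x \<in> K" "x \<noteq> 0" "algebraic_int x"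
  shows "0 \<le> (\<Sum>i<d. ln (norm (\<sigma> i x)))"
proof -
  have "(\<Sum>i<d. ln (norm (\<sigma> i x))) = ln (\<Prod>i<d. norm (\<sigma> i x))"
    using hom_nonzero assms by (subst ln_prod) auto
  then show ?thesis using norm_ge_1[OF assms] by simp
qed

text \<open>Northcott's argument: only finitely many polynomials with roots
  \<open>\<sigma> i x\<close> can occur, because each has degree at most \<open>d\<close> and takes
  bounded integral values at the \<open>d + 1\<close> points from 0 to \<open>d\<close>.\<close>

lemma finite_bounded_algebraic_ints:
  "finite {x \<in> K. algebraic_int x \<and> (\<forall>i<d. norm (\<sigma> i x) \<le> B)}" (is "finite ?T")
proof -
  define P where "P x = (\<Prod>i<d. [:- \<sigma> i x, 1:])" for x
  define ev where "ev Q = (\<lambda>t\<in>{..d}. poly Q (of_nat t :: complex))" for Q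
  define R where "R = (real d + \<bar>B\<bar>) ^ d"
  define Z where "Z = {z :: complex. z \<in> \<int> \<and> norm z \<le> R}"
  have degP: "degree (P x) \<le> d" for x
  proof -
    have "degree (P x) \<le> sum (degree \<circ> (\<lambda>i. [:- \<sigma> i x, 1:])) {..<d}"
      unfolding P_def by (rule degree_prod_sum_le) simp
    then show ?thesis by simp
  qed
  \<comment> \<open>Values at natural numbers are norms of elements of \<open>K\<close>, so
    \<open>norm_int\<close> gives their integrality directly.\<close>
  have val: "poly (P x) (of_nat t) = (\<Prod>i<d. \<sigma> i (of_nat t - x))" if "x \<in> K" for x t
    using that by (simp add: P_def poly_prod hom_diff of_nat_closed hom_of_nat)
  have "Z \<subseteq> of_int ` {- \<lceil>R\<rceil>..\<lceil>R\<rceil>}"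
  proof
    fix z assume z: "z \<in> Z"
    then obtain k where k: "z = of_int k" by (auto simp: Z_def elim: Ints_cases)
    then have "\<bar>real_of_int k\<bar> \<le> R" using z by (simp add: Z_def)
    then have "k \<in> {- \<lceil>R\<rceil>..\<lceil>R\<rceil>}" by (auto; linarith)
    then show "z \<in> of_int ` {- \<lceil>R\<rceil>..\<lceil>R\<rceil>}" using k by blast
  qed
  then have finZ: "finite Z" by (rule finite_subset) simp
  have "ev (P x) \<in> {..d} \<rightarrow>\<^sub>E Z" if x: "x \<in> ?T" for x
  proof
    fix t assume t: "t \<in> {..d}"
    have "(\<Prod>i<d. \<sigma> i (of_nat t - x)) \<in> \<int>"
      using x by (intro norm_int diff_closed of_nat_closed algebraic_int_diff) (auto intro: int_imp_algebraic_int)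
    moreover have "norm (\<Prod>i<d. \<sigma> i (of_nat t - x)) \<le> (\<Prod>i<d. real d + \<bar>B\<bar>)"
      unfolding prod_norm[symmetric]
    proof (intro prod_mono conjI norm_ge_zero)
      fix i assume i: "i \<in> {..<d}"
      have eq: "\<sigma> i (of_nat t - x) = of_nat t - \<sigma> i x"
        using i x by (simp add: hom_diff of_nat_closed hom_of_nat)
      have "norm (\<sigma> i x) \<le> B" using x i by auto
      moreover have "norm (of_nat t - \<sigma> i x) \<le> norm (of_nat t :: complex) + norm (\<sigma> i x)"
        by (rule norm_triangle_ineq4)
      moreover have "norm (of_nat t :: complex) \<le> real d" using t by simp
      ultimately show "norm (\<sigma> i (of_nat t - x)) \<le> real d + \<bar>B\<bar>"
        unfolding eq by linarith
    qed
    ultimately show "ev (P x) t \<in> Z" using t x val by (simp add: ev_def Z_def R_def)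
  qed (simp add: ev_def)
  then have "finite (ev ` (P ` ?T))"
    by (intro finite_subset[OF _ finite_PiE[of "{..d}" "\<lambda>_. Z"]]) (use finZ in auto)
  moreover have "inj_on ev (P ` ?T)"
  proof (rule inj_onI)
    fix Q Q' assume Q: "Q \<in> P ` ?T" "Q' \<in> P ` ?T" "ev Q = ev Q'"
    have card: "card ((of_nat :: nat \<Rightarrow> complex) ` {..d}) = Suc d"
      by (simp add: card_image inj_on_def)
    show "Q = Q'"
    proof (rule poly_eqI_degree[of "of_nat ` {..d}"])
      fix z :: complex assume "z \<in> of_nat ` {..d}"
      then obtain t where "t \<in> {..d}" "z = of_nat t" by blast
      then show "poly Q z = poly Q' z" using fun_cong[OF Q(3), of t] by (simp add: ev_def)
    qed (use Q degP card in \<open>auto simp: le_imp_less_Suc\<close>)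
  qed
  ultimately have fin: "finite (P ` ?T)" by (rule finite_imageD)
  \<comment> \<open>A polynomial determines \<open>x\<close> up to finitely many choices, since
    \<open>\<sigma> 0 x\<close> is one of its roots and \<open>\<sigma> 0\<close> is injective on
    \<open>K\<close>.\<close>
  have "finite {x \<in> K. poly (P y) (\<sigma> 0 x) = 0}" for y
  proof (rule finite_imageD)
    have "P y \<noteq> 0" by (simp add: P_def)
    then show "finite (\<sigma> 0 ` {x \<in> K. poly (P y) (\<sigma> 0 x) = 0})"
      by (intro finite_subset[OF _ poly_roots_finite[of "P y"]]) auto
    show "inj_on (\<sigma> 0) {x \<in> K. poly (P y) (\<sigma> 0 x) = 0}"
      using inj_on_hom[OF degree_pos] by (rule inj_on_subset) auto
  qed
  then have "finite (\<Union>Q\<in>P ` ?T. {x \<in> K. poly Q (\<sigma> 0 x) = 0})"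
    by (intro finite_UN_I[OF fin]) auto
  moreover have "?T \<subseteq> (\<Union>Q\<in>P ` ?T. {x \<in> K. poly Q (\<sigma> 0 x) = 0})"
    using degree_pos by (auto simp: P_def poly_prod)
  ultimately show ?thesis by (rule finite_subset[rotated])
qed

section \<open>Units and heights\<close>

definition unit_elt :: "'b \<Rightarrow> bool" where
  "unit_elt x \<longleftrightarrow> x \<in> K \<and> x \<noteq> 0 \<and> algebraic_int x \<and> algebraic_int (inverse x)"

definition exceptional_units :: "'b set" where
  "exceptional_units = {x. unit_elt x \<and> unit_elt (1 - x)}"

lemma unit_elt_mult: "unit_elt x \<Longrightarrow> unit_elt y \<Longrightarrow> unit_elt (x * y)"
  by (auto simp: unit_elt_def mult_closed algebraic_int_mult)

lemma unit_elt_inverse: "unit_elt x \<Longrightarrow> unit_elt (inverse x)"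
  by (auto simp: unit_elt_def inverse_closed)

lemma unit_elt_power: "unit_elt x \<Longrightarrow> unit_elt (x ^ k)"
  by (auto simp: unit_elt_def power_closed algebraic_int_power simp flip: power_inverse)

text \<open>Both the unit and its inverse have norm at least 1 in absolute value.\<close>

lemma sum_ln_unit:
  assumes "unit_elt x"
  shows "(\<Sum>i<d. ln (norm (\<sigma> i x))) = 0"
proof -
  have "(\<Sum>i<d. ln (norm (\<sigma> i (inverse x)))) = - (\<Sum>i<d. ln (norm (\<sigma> i x)))"
    using assms by (simp add: hom_inverse norm_inverse ln_inverse unit_elt_def hom_nonzero sum_negf)
  then show ?thesis
    using sum_ln_nonneg[of x] sum_ln_nonneg[of "inverse x"] assms inverse_closed
    by (simp add: unit_elt_def)
qed

text \<open>The archimedean absolute values of the point \<open>(1 : x : y)\<close>; a unit point has trivial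
  absolute values at all other places.\<close>

definition height :: "'b \<Rightarrow> 'b \<Rightarrow> real" where
  "height x y = (\<Sum>i<d. ln (max 1 (max (norm (\<sigma> i x)) (norm (\<sigma> i y)))))"

end

section \<open>Integrality and estimates at a single absolute value\<close>

lemma algebraic_int_pade:
  "algebraic_int u \<Longrightarrow> algebraic_int v \<Longrightarrow> algebraic_int (pade l m n u v :: 'a::field_char_0)"
  by (induction l m n u v rule: pade.induct) (auto intro: algebraic_int_diff algebraic_int_mult)

text \<open>The bounds cover both \<open>j = 0\<close> and \<open>j = 1\<close>: the first
  coefficient has degree \<open>N + j\<close>, the second gets \<open>j\<close> further powers from
  \<open>y ^ j\<close>, the third has degree \<open>N\<close>.\<close>

lemma pade_coeff_bound:
  fixes x y :: "'a::real_normed_field"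
  fixes H :: real
  assumes H: "norm x \<le> H" "norm y \<le> H" "1 \<le> H" and j: "j \<in> {0,1}"
  shows "norm (pade (Suc N + j) (Suc N) (Suc N) (-1) (-y)) \<le> 2 ^ (3 * N + 3) * H ^ (N + 1)"
    "norm (y ^ j * pade (Suc N) (Suc N + j) (Suc N) 1 x) \<le> 2 ^ (3 * N + 3) * H ^ (N + 1)"
    "norm (- pade (Suc N) (Suc N + j) (Suc N) y (-x)) \<le> 2 ^ (3 * N + 3) * H ^ (N + 1)"
proof -
  have mono: "2 ^ a * H ^ b \<le> 2 ^ (3 * N + 3) * H ^ (N + 1)" if "a \<le> 3 * N + 3" "b \<le> N + 1" for a b
    using that H(3) by (intro mult_mono power_increasing) auto
  have j1: "j \<le> 1" using j by auto
  show "norm (pade (Suc N + j) (Suc N) (Suc N) (-1) (-y)) \<le> 2 ^ (3 * N + 3) * H ^ (N + 1)"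
    using norm_pade_le[of "-1" H "-y" "N + j" "Suc N" "Suc N"] H j1
    by (intro order.trans[OF _ mono[of "N + j + Suc N + Suc N" "N + j"]]) (auto simp del: pade.simps)
  have B: "norm (pade (Suc N) (Suc N + j) (Suc N) 1 x) \<le> 2 ^ (N + (Suc N + j) + Suc N) * H ^ N"
    using norm_pade_le[of "1 :: 'a" H x N "Suc N + j" "Suc N"] H by simp
  have "norm (y ^ j * pade (Suc N) (Suc N + j) (Suc N) 1 x) \<le> H ^ j * (2 ^ (N + (Suc N + j) + Suc N) * H ^ N)"
    unfolding norm_mult norm_power using H B by (intro mult_mono power_mono) auto
  also have "\<dots> = 2 ^ (N + (Suc N + j) + Suc N) * H ^ (N + j)" by (simp add: power_add)
  also have "\<dots> \<le> 2 ^ (3 * N + 3) * H ^ (N + 1)" using j1 by (intro mono) auto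
  finally show "norm (y ^ j * pade (Suc N) (Suc N + j) (Suc N) 1 x) \<le> 2 ^ (3 * N + 3) * H ^ (N + 1)" .
  show "norm (- pade (Suc N) (Suc N + j) (Suc N) y (-x)) \<le> 2 ^ (3 * N + 3) * H ^ (N + 1)"
    using norm_pade_le[of y H "-x" N "Suc N + j" "Suc N"] H j1
    by (intro order.trans[OF _ mono[of "N + (Suc N + j) + Suc N" N]]) (auto simp del: pade.simps)
qed

text \<open>The vector \<open>(x ^ k, y ^ k, 1)\<close> is orthogonal to \<open>(A, B, C)\<close>
  and to \<open>(\<epsilon>, \<eta>, - 1)\<close>. Its multiple by
  \<open>A * \<eta> - B * \<epsilon>\<close> is therefore their cross product, each entry of which
  is a sum of two bounded products.\<close>

lemma minor_bound:
  fixes A B C x y \<epsilon> \<eta> :: "'a::real_normed_field"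
  assumes rel: "A * x ^ k + B * y ^ k + C = 0" "\<epsilon> * x ^ k + \<eta> * y ^ k = 1"
    and W: "norm A \<le> W" "norm B \<le> W" "norm C \<le> W"
  shows "norm (A * \<eta> - B * \<epsilon>) * max 1 (max (norm x) (norm y)) ^ k \<le> 2 * W * max 1 (max (norm \<epsilon>) (norm \<eta>))"
proof -
  let ?E = "max 1 (max (norm \<epsilon>) (norm \<eta>))" and ?D = "A * \<eta> - B * \<epsilon>"
  have solve: "a = - b - c" if "a + b + c = 0" for a b c :: 'a
  proof -
    have "a = - (b + c)" using that by (simp only: eq_neg_iff_add_eq_0 add.assoc)
    then show ?thesis by simp
  qed
  have W0: "0 \<le> W" using W(1) norm_ge_zero order_trans by blast
  have two: "norm (a * p + b * q) \<le> 2 * W * ?E"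
    if "norm a \<le> W" "norm b \<le> W" "norm p \<le> ?E" "norm q \<le> ?E" for a b p q :: 'a
  proof -
    have "norm (a * p + b * q) \<le> norm a * norm p + norm b * norm q"
      by (metis norm_mult norm_triangle_ineq)
    also have "\<dots> \<le> W * ?E + W * ?E" using that W0 by (intro add_mono mult_mono) auto
    finally show ?thesis by simp
  qed
  have 1: "norm ?D * 1 \<le> 2 * W * ?E" using two[of A "- B" \<eta> \<epsilon>] W by simp
  have "?D * x ^ k = \<eta> * (A * x ^ k) - B * (\<epsilon> * x ^ k)" by (simp add: algebra_simps)
  also have "A * x ^ k = - (B * y ^ k) - C" by (rule solve) (rule rel(1))
  also have "\<epsilon> * x ^ k = 1 - \<eta> * y ^ k" using rel(2) by (simp add: eq_diff_eq)
  also have "\<eta> * (- (B * y ^ k) - C) - B * (1 - \<eta> * y ^ k) = (- C) * \<eta> + (- B) * 1" by (simp add: algebra_simps)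
  finally have 2: "norm ?D * norm x ^ k \<le> 2 * W * ?E"
    using two[of "- C" "- B" \<eta> 1] W by (simp flip: norm_mult norm_power)
  have "?D * y ^ k = A * (\<eta> * y ^ k) - \<epsilon> * (B * y ^ k)" by (simp add: algebra_simps)
  also have "\<eta> * y ^ k = 1 - \<epsilon> * x ^ k" using rel(2) by (simp add: eq_diff_eq add.commute)
  also have "B * y ^ k = - (A * x ^ k) - C" by (rule solve) (use rel(1) in \<open>simp add: add_ac\<close>)
  also have "A * (1 - \<epsilon> * x ^ k) - \<epsilon> * (- (A * x ^ k) - C) = A * 1 + C * \<epsilon>" by (simp add: algebra_simps)
  finally have 3: "norm ?D * norm y ^ k \<le> 2 * W * ?E"
    using two[of A C 1 \<epsilon>] W by (simp flip: norm_mult norm_power)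
  show ?thesis using 1 2 3 by (auto simp: max_def power_one)
qed

declare pade.simps [simp del]

context number_embeddings
begin

text \<open>As \<open>\<epsilon>\<close> and \<open>\<eta>\<close> are units,
  \<open>D = A * \<eta> - B * \<epsilon>\<close> is an algebraic integer, nonzero by the choice of
  the relation, so its logarithms have nonnegative sum; \<open>minor_bound\<close> estimates each of
  them. In \<open>3 * N + 4\<close> the exponent of \<open>pade_coeff_bound\<close> is raised by one
  for the factor 2 of \<open>minor_bound\<close>.\<close>

lemma height_gap:
  fixes N :: nat
  assumes x: "x \<in> exceptional_units" and x': "x' \<in> exceptional_units"
  defines "k \<equiv> 2 * N + 1"
  shows "real N * height x (1 - x) - real d * real (3 * N + 4) * ln 2
    \<le> height (x' * inverse (x ^ k)) ((1 - x') * inverse ((1 - x) ^ k))"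
proof -
  define y where "y = 1 - x"
  define y' where "y' = 1 - x'"
  define \<epsilon> where "\<epsilon> = x' * inverse (x ^ k)"
  define \<eta> where "\<eta> = y' * inverse (y ^ k)"
  have u: "unit_elt x" "unit_elt y" "unit_elt x'" "unit_elt y'"
    using x x' by (auto simp: exceptional_units_def y_def y'_def)
  then have ue: "unit_elt \<epsilon>" "unit_elt \<eta>"
    by (auto simp: \<epsilon>_def \<eta>_def intro!: unit_elt_mult unit_elt_inverse unit_elt_power)
  have nz: "x \<noteq> 0" "y \<noteq> 0" and in_K: "x \<in> K" "y \<in> K" "\<epsilon> \<in> K" "\<eta> \<in> K" using u ue by (auto simp: unit_elt_def)
  have xy: "x + y = 1" "x' + y' = 1" by (auto simp: y_def y'_def)
  have x'e: "x' = \<epsilon> * x ^ k" "y' = \<eta> * y ^ k" using nz by (simp_all add: \<epsilon>_def \<eta>_def)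
  obtain A B C j where rel: "A * x ^ k + B * y ^ k + C = 0" "A * x ^ k * y' \<noteq> B * y ^ k * x'"
    and j: "j \<in> {0, 1}" and A: "A = pade (Suc N + j) (Suc N) (Suc N) (-1) (-y)"
    and B: "B = y ^ j * pade (Suc N) (Suc N + j) (Suc N) 1 x"
    and C: "C = - pade (Suc N) (Suc N + j) (Suc N) y (-x)"
    using pade_relation[OF xy(1) nz xy(2), of N] unfolding k_def by metis
  define D where "D = A * \<eta> - B * \<epsilon>"
  have K: "A \<in> K" "B \<in> K" "C \<in> K" "D \<in> K"
    unfolding A B C D_def
    by (intro pade_closed mult_closed minus_closed diff_closed power_closed one_closed in_K)+
  have "algebraic_int A" "algebraic_int B"
    unfolding A B using u unfolding unit_elt_def
    by (intro algebraic_int_pade algebraic_int_mult algebraic_int_power; simp)+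
  then have "algebraic_int D"
    unfolding D_def using ue by (auto simp: unit_elt_def intro: algebraic_int_diff algebraic_int_mult)
  moreover have D0: "D \<noteq> 0"
  proof
    assume "D = 0"
    then have "A * \<eta> = B * \<epsilon>" by (simp add: D_def)
    moreover have "A * x ^ k * y' = (A * \<eta>) * (x ^ k * y ^ k)" "B * y ^ k * x' = (B * \<epsilon>) * (x ^ k * y ^ k)"
      by (simp_all only: x'e mult_ac)
    ultimately have "A * x ^ k * y' = B * y ^ k * x'" by metis
    then show False using rel(2) by blast
  qed
  ultimately have "0 \<le> (\<Sum>i<d. ln (norm (\<sigma> i D)))" using sum_ln_nonneg K by blast
  also have "\<dots> \<le> (\<Sum>i<d. real (3 * N + 4) * ln 2 - real N * ln (max 1 (max (norm (\<sigma> i x)) (norm (\<sigma> i y))))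
      + ln (max 1 (max (norm (\<sigma> i \<epsilon>)) (norm (\<sigma> i \<eta>)))))"
  proof (rule sum_mono)
    fix i assume "i \<in> {..<d}"
    then have i: "i < d" by simp
    let ?H = "max 1 (max (norm (\<sigma> i x)) (norm (\<sigma> i y)))" and ?E = "max 1 (max (norm (\<sigma> i \<epsilon>)) (norm (\<sigma> i \<eta>)))"
    let ?W = "2 ^ (3 * N + 3) * ?H ^ (N + 1)"
    have s: "\<sigma> i A = pade (Suc N + j) (Suc N) (Suc N) (-1) (- \<sigma> i y)"
      "\<sigma> i B = \<sigma> i y ^ j * pade (Suc N) (Suc N + j) (Suc N) 1 (\<sigma> i x)"
      "\<sigma> i C = - pade (Suc N) (Suc N + j) (Suc N) (\<sigma> i y) (- \<sigma> i x)"
      unfolding A B C using i in_K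
      by (simp_all only: hom_pade hom_mult hom_power hom_minus hom_one minus_closed one_closed pade_closed
          power_closed)
    have H: "norm (\<sigma> i x) \<le> ?H" "norm (\<sigma> i y) \<le> ?H" "1 \<le> ?H" by auto
    have W: "norm (\<sigma> i A) \<le> ?W" "norm (\<sigma> i B) \<le> ?W" "norm (\<sigma> i C) \<le> ?W"
      unfolding s by (rule pade_coeff_bound[OF H j])+
    have "\<sigma> i (A * x ^ k + B * y ^ k + C) = 0" "\<sigma> i (\<epsilon> * x ^ k + \<eta> * y ^ k) = 1"
      using rel(1) xy(2) x'e hom_zero[OF i] hom_one[OF i] by auto
    then have "\<sigma> i A * \<sigma> i x ^ k + \<sigma> i B * \<sigma> i y ^ k + \<sigma> i C = 0" "\<sigma> i \<epsilon> * \<sigma> i x ^ k + \<sigma> i \<eta> * \<sigma> i y ^ k = 1"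
      using i K in_K by (simp_all add: hom_add hom_mult hom_power add_closed mult_closed power_closed)
    from minor_bound[OF this W] have "norm (\<sigma> i D) * ?H ^ k \<le> 2 * ?W * ?E"
      using i K in_K by (simp add: D_def hom_diff hom_mult mult_closed)
    also have "\<dots> = 2 ^ (3 * N + 4) * ?E * ?H ^ (N + 1)" by (simp add: power_add)
    \<comment> \<open>The coefficients use up \<open>N + 1\<close> of the \<open>2 * N + 1\<close>
      powers; \<open>N\<close> of them remain.\<close>
    also have "?H ^ k = ?H ^ N * ?H ^ (N + 1)" by (simp add: k_def mult_2 flip: power_add)
    finally have "norm (\<sigma> i D) * ?H ^ N * ?H ^ (N + 1) \<le> 2 ^ (3 * N + 4) * ?E * ?H ^ (N + 1)"
      by (simp only: mult.assoc)
    then have le: "norm (\<sigma> i D) * ?H ^ N \<le> 2 ^ (3 * N + 4) * ?E"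
      by (rule mult_right_le_imp_le) (simp add: less_max_iff_disj)
    have pos: "norm (\<sigma> i D) > 0" "?H > 0" "?E > 0" using hom_nonzero[OF i K(4) D0] by (auto simp: less_max_iff_disj)
    have "ln (norm (\<sigma> i D)) + real N * ln ?H = ln (norm (\<sigma> i D) * ?H ^ N)"
      using pos by (simp add: ln_mult_pos ln_realpow del: zero_less_norm_iff)
    also have "\<dots> \<le> ln (2 ^ (3 * N + 4) * ?E)"
      using le pos by (intro ln_mono mult_pos_pos zero_less_power) auto
    also have "\<dots> = real (3 * N + 4) * ln 2 + ln ?E"
      using pos by (simp add: ln_mult_pos ln_realpow)
    finally show "ln (norm (\<sigma> i D)) \<le> real (3 * N + 4) * ln 2 - real N * ln ?H + ln ?E" by linarith
  qed
  also have "\<dots> = real d * real (3 * N + 4) * ln 2 - real N * height x y + height \<epsilon> \<eta>"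
    by (simp add: height_def sum.distrib sum_subtractf sum_distrib_left)
  finally show ?thesis by (simp add: y_def y'_def \<epsilon>_def \<eta>_def)
qed

lemma height_summand_le: "i < d \<Longrightarrow> ln (max 1 (max (norm (\<sigma> i x)) (norm (\<sigma> i y)))) \<le> height x y"
  unfolding height_def by (rule member_le_sum) auto

text \<open>The logarithms of a unit sum to 0, so a negative one is balanced by the others, whose
  positive parts the height bounds.\<close>

lemma abs_ln_le_height:
  assumes "unit_elt x" "i < d"
  shows "\<bar>ln (norm (\<sigma> i x))\<bar> \<le> height x y" "\<bar>ln (norm (\<sigma> i x))\<bar> \<le> height y x"
proof -
  define b where "b j = ln (max 1 (max (norm (\<sigma> j x)) (norm (\<sigma> j y))))" for j
  have pos: "norm (\<sigma> j x) > 0" if "j < d" for j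
    using assms(1) hom_nonzero that by (simp add: unit_elt_def)
  have le: "ln (norm (\<sigma> j x)) \<le> b j" if "j < d" for j
    unfolding b_def using pos[OF that] by (intro ln_mono) auto
  have b0: "0 \<le> b j" for j unfolding b_def by simp
  have "- ln (norm (\<sigma> i x)) = (\<Sum>j\<in>{..<d} - {i}. ln (norm (\<sigma> j x)))"
    using sum_ln_unit[OF assms(1)] assms(2) by (simp add: sum_diff1)
  also have "\<dots> \<le> (\<Sum>j\<in>{..<d} - {i}. b j)" using le by (intro sum_mono) auto
  also have "\<dots> \<le> (\<Sum>j<d. b j)" using b0 by (intro sum_mono2) auto
  finally have "- ln (norm (\<sigma> i x)) \<le> height x y" by (simp add: height_def b_def)
  moreover have "ln (norm (\<sigma> i x)) \<le> height x y"
    using le[OF assms(2)] height_summand_le[OF assms(2)] unfolding b_def by (rule order.trans)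
  ultimately show "\<bar>ln (norm (\<sigma> i x))\<bar> \<le> height x y" by linarith
  then show "\<bar>ln (norm (\<sigma> i x))\<bar> \<le> height y x" by (simp add: height_def max.commute)
qed

lemma finite_height_le:
  "finite {x \<in> exceptional_units. height x (1 - x) \<le> B}"
proof (rule finite_subset[OF _ finite_bounded_algebraic_ints[of "exp B"]], safe)
  fix x assume x: "x \<in> exceptional_units" and le: "height x (1 - x) \<le> B"
  show "x \<in> K" "algebraic_int x" using x by (auto simp: exceptional_units_def unit_elt_def)
  fix i assume i: "i < d"
  have u: "unit_elt x" using x by (simp add: exceptional_units_def)
  then have "norm (\<sigma> i x) > 0" using i hom_nonzero by (simp add: unit_elt_def)
  moreover have "ln (norm (\<sigma> i x)) \<le> B" using abs_ln_le_height(1)[OF u i, of "1 - x"] le by linarith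
  ultimately show "norm (\<sigma> i x) \<le> exp B" by (metis exp_le_cancel_iff exp_ln)
qed

text \<open>Two solutions of large height whose logarithmic vectors are almost parallel violate
  \<open>height_gap\<close> for the odd number \<open>2 N + 1\<close> just below the quotient of their heights.\<close>

lemma height_gap_contradiction:
  fixes M :: real
  assumes x: "x \<in> exceptional_units" and x': "x' \<in> exceptional_units"
  defines "h \<equiv> height x (1 - x)" and "h' \<equiv> height x' (1 - x')"
  assumes h: "h \<ge> 100 * real d" and h': "h' \<ge> 7 * h" and M: "M \<ge> 100 * real d"
    and close: "\<And>i. i < d \<Longrightarrow> M * (ln (norm (\<sigma> i x')) / h') \<le> M * (ln (norm (\<sigma> i x)) / h) + 1"
      "\<And>i. i < d \<Longrightarrow> M * (ln (norm (\<sigma> i (1 - x'))) / h') \<le> M * (ln (norm (\<sigma> i (1 - x))) / h) + 1"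
  shows False
proof -
  have d1: "real d \<ge> 1" using degree_pos by linarith
  have hp: "h > 0" "h' > 0" "M > 0" using h h' M d1 by linarith+
  define \<rho> where "\<rho> = h' / h"
  have \<rho>: "\<rho> \<ge> 7" "h' = \<rho> * h" using h' hp by (simp_all add: \<rho>_def le_divide_eq)
  \<comment> \<open>The largest \<open>N\<close> with \<open>2 * N + 1 \<le> \<rho>\<close>; from
    \<open>\<rho> \<ge> 7\<close> it exceeds 2.\<close>
  define N where "N = nat \<lfloor>(\<rho> - 1) / 2\<rfloor>"
  have Nf: "real N = of_int \<lfloor>(\<rho> - 1) / 2\<rfloor>" using \<rho> by (simp add: N_def)
  have "real N \<le> (\<rho> - 1) / 2" "(\<rho> - 1) / 2 < real N + 1" unfolding Nf by linarith+
  then have N: "2 * real N + 1 \<le> \<rho>" "\<rho> < 2 * real N + 3" by auto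
  then have N3: "real N > 2" using \<rho> by linarith
  define k where "k = 2 * N + 1"
  have k: "real k = 2 * real N + 1" by (simp add: k_def)
  define u where "u i = ln (max 1 (max (norm (\<sigma> i x)) (norm (\<sigma> i (1 - x)))))" for i
  have units: "unit_elt x" "unit_elt (1 - x)" "unit_elt x'" "unit_elt (1 - x')"
    using x x' by (auto simp: exceptional_units_def)
  have pos: "norm (\<sigma> i z) > 0" if "unit_elt z" "i < d" for i z
    using that hom_nonzero by (simp add: unit_elt_def)
  have ln_eps: "ln (norm (\<sigma> i (z' * inverse (z ^ k)))) = ln (norm (\<sigma> i z')) - real k * ln (norm (\<sigma> i z))"
    if "unit_elt z" "unit_elt z'" "i < d" for z z' i
    using that pos[OF that(1,3)] pos[OF that(2,3)]
    by (simp add: unit_elt_def hom_mult hom_inverse hom_power inverse_closed power_closed norm_mult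
        norm_inverse norm_power ln_mult_pos ln_inverse ln_realpow hom_nonzero)
  have bound: "ln (norm (\<sigma> i (z' * inverse (z ^ k)))) \<le> h' / M + (\<rho> - k) * u i"
    if z: "unit_elt z" "unit_elt z'" "i < d" and le: "ln (norm (\<sigma> i z)) \<le> u i"
      and cl: "M * (ln (norm (\<sigma> i z')) / h') \<le> M * (ln (norm (\<sigma> i z)) / h) + 1" for z z' i
  proof -
    have "ln (norm (\<sigma> i z')) / h' \<le> ln (norm (\<sigma> i z)) / h + 1 / M"
    proof -
      have "a \<le> b + 1 / M" if "M * a \<le> M * b + 1" for a b :: real
      proof -
        have "M * a \<le> M * (b + 1 / M)" using that hp(3) by (simp add: distrib_left)
        then show ?thesis using hp(3) by (simp only: mult_le_cancel_left_pos)
      qed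
      then show ?thesis using cl by blast
    qed
    then have "ln (norm (\<sigma> i z')) \<le> (ln (norm (\<sigma> i z)) / h + 1 / M) * h'"
      using hp by (simp add: pos_divide_le_eq)
    also have "\<dots> = \<rho> * ln (norm (\<sigma> i z)) + h' / M"
      using hp by (simp add: \<rho>_def distrib_right)
    finally have "ln (norm (\<sigma> i z')) - real k * ln (norm (\<sigma> i z)) \<le> h' / M + (\<rho> - k) * ln (norm (\<sigma> i z))"
      by (simp add: algebra_simps)
    \<comment> \<open>Since \<open>k \<le> \<rho>\<close>, the coefficient is nonnegative and the
      logarithm may be replaced by its upper bound \<open>u i\<close>.\<close>
    also have "\<dots> \<le> h' / M + (\<rho> - k) * u i"
      using le N k by (intro add_left_mono mult_left_mono) auto
    finally show ?thesis unfolding ln_eps[OF z(1-3)] .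
  qed
  let ?\<epsilon> = "x' * inverse (x ^ k)" and ?\<eta> = "(1 - x') * inverse ((1 - x) ^ k)"
  have "height ?\<epsilon> ?\<eta> \<le> (\<Sum>i<d. h' / M + (\<rho> - k) * u i)"
    unfolding height_def
  proof (rule sum_mono)
    fix i assume "i \<in> {..<d}"
    then have i: "i < d" by simp
    have u: "ln (norm (\<sigma> i x)) \<le> u i" "ln (norm (\<sigma> i (1 - x))) \<le> u i" "0 \<le> u i"
      unfolding u_def using pos[OF units(1) i] pos[OF units(2) i] by (auto intro!: ln_mono)
    have "0 \<le> h' / M + (\<rho> - k) * u i" using hp u N k by simp
    moreover have "ln (norm (\<sigma> i ?\<epsilon>)) \<le> h' / M + (\<rho> - k) * u i"
      "ln (norm (\<sigma> i ?\<eta>)) \<le> h' / M + (\<rho> - k) * u i"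
      using bound[OF units(1,3) i u(1) close(1)[OF i]] bound[OF units(2,4) i u(2) close(2)[OF i]] by auto
    ultimately show "ln (max 1 (max (norm (\<sigma> i ?\<epsilon>)) (norm (\<sigma> i ?\<eta>)))) \<le> h' / M + (\<rho> - k) * u i"
      by (simp add: max_def)
  qed
  also have "\<dots> = real d * h' / M + (\<rho> - k) * h"
    by (simp add: sum.distrib h_def height_def u_def flip: sum_distrib_left)
  \<comment> \<open>Here \<open>d / M\<close> is at most 1/100, and \<open>h' = \<rho> * h\<close>
    with \<open>\<rho> < 2 * N + 3\<close>.\<close>
  also have "real d * h' / M \<le> (2 * real N + 3) * h / 100"
  proof -
    have "real d * h' * 100 \<le> h' * M" using M hp by (simp add: mult.commute mult.assoc mult_left_mono)
    then have "real d * h' / M \<le> h' / 100" using hp by (simp add: divide_le_eq mult.commute)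
    also have "\<dots> \<le> (2 * real N + 3) * h / 100" using N hp \<rho> by (simp add: mult_right_mono)
    finally show ?thesis .
  qed
  also have "(\<rho> - k) * h \<le> 2 * h" using N k hp by (intro mult_right_mono) auto
  finally have "height ?\<epsilon> ?\<eta> \<le> (2 * real N + 3) * h / 100 + 2 * h" by simp
  then have le: "real N * h - real d * real (3 * N + 4) * ln 2 \<le> (2 * real N + 3) * h / 100 + 2 * h"
    using height_gap[OF x x', of N] unfolding k_def h_def by linarith
  have "real d * real (3 * N + 4) * ln 2 \<le> real d * real (3 * N + 4) * 1"
    using ln_le_minus_one[of 2] by (intro mult_left_mono) auto
  also have "\<dots> \<le> h / 100 * real (3 * N + 4)" using h by (simp add: mult_right_mono)
  finally have "real N * h \<le> h / 100 * real (3 * N + 4) + ((2 * real N + 3) * h / 100 + 2 * h)"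
    using le by argo
  \<comment> \<open>The terms \<open>3 * N + 4\<close>, \<open>2 * N + 3\<close> and 200 add up to
    \<open>5 * N + 207\<close>; thus \<open>95 * N \<le> 207\<close>, against
    \<open>N \<ge> 3\<close>.\<close>
  also have "\<dots> = 5 / 100 * (real N * h) + 207 / 100 * h" by (simp add: field_simps)
  finally have "95 * (real N * h) \<le> 207 * h" by argo
  moreover have "3 * h \<le> real N * h" using N3 hp by (intro mult_right_mono) auto
  ultimately show False using hp by argo
qed

text \<open>The pigeonhole principle for normalised logarithmic vectors gives an infinite cell;
  finiteness for bounded height then allows a second solution in it of at least 7 times the height
  of the first.\<close>

theorem finite_exceptional_units: "finite exceptional_units"
proof (rule ccontr)
  assume inf: "infinite exceptional_units"
  define h where "h x = height x (1 - x)" for x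
  define M where "M = 100 * d"
  define S where "S = {x \<in> exceptional_units. h x \<ge> 100 * real d}"
  \<comment> \<open>Discarding all solutions of small height leaves an infinite set
    infinite.\<close>
  have large: "infinite {x \<in> T. h x \<ge> B}" if "infinite T" "T \<subseteq> exceptional_units" for T B
  proof
    assume "finite {x \<in> T. h x \<ge> B}"
    moreover have "finite {x \<in> T. h x \<le> B}"
      using that(2) by (intro finite_subset[OF _ finite_height_le[of B]]) (auto simp: h_def)
    ultimately have "finite ({x \<in> T. h x \<ge> B} \<union> {x \<in> T. h x \<le> B})" by simp
    moreover have "{x \<in> T. h x \<ge> B} \<union> {x \<in> T. h x \<le> B} = T" by auto
    ultimately show False using that(1) by simp
  qed
  \<comment> \<open>Normalised logarithms lie between -1 and 1 by \<open>abs_ln_le_height\<close>;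
    in a common cell they differ by less than \<open>1 / M\<close>.\<close>
  define cell where "cell x = (\<lambda>i\<in>{..<d}. (\<lfloor>real M * (ln (norm (\<sigma> i x)) / h x)\<rfloor>,
      \<lfloor>real M * (ln (norm (\<sigma> i (1 - x))) / h x)\<rfloor>))" for x
  have range: "\<lfloor>real M * (t / s)\<rfloor> \<in> {- int M..int M}" if "\<bar>t\<bar> \<le> s" for t s :: real
  proof -
    have "\<bar>t / s\<bar> \<le> 1" using that by (auto simp: abs_divide divide_le_eq)
    then have "\<bar>real M * (t / s)\<bar> \<le> real M * 1" unfolding abs_mult by (intro mult_mono) auto
    then have "- real M \<le> real M * (t / s)" "real M * (t / s) \<le> real M" by (simp_all only: abs_le_iff) auto
    then show ?thesis by (auto simp: le_floor_iff floor_le_iff)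
  qed
  have "infinite S" unfolding S_def by (rule large[OF inf]) simp
  moreover have "finite (cell ` S)"
  proof (rule finite_subset)
    show "cell ` S \<subseteq> {..<d} \<rightarrow>\<^sub>E {- int M..int M} \<times> {- int M..int M}"
      unfolding cell_def S_def exceptional_units_def h_def image_subset_iff restrict_PiE_iff
      by (intro ballI SigmaI range abs_ln_le_height) auto
  qed (intro finite_PiE; simp)
  ultimately obtain x0 where x0: "infinite {x \<in> S. cell x = cell x0}"
    using pigeonhole_infinite by blast
  let ?T = "{x \<in> S. cell x = cell x0}"
  obtain x where x: "x \<in> ?T" using x0 by (metis ex_in_conv finite.emptyI)
  have "infinite {x' \<in> ?T. h x' \<ge> 7 * h x}" by (rule large[OF x0]) (auto simp: S_def)
  then obtain x' where x': "x' \<in> ?T" "h x' \<ge> 7 * h x"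
    by (metis (mono_tags, lifting) empty_Collect_eq finite.emptyI)
  have eq: "cell x' i = cell x i" for i using x x' by simp
  have floor_close: "s \<le> t + 1" if "\<lfloor>s\<rfloor> = \<lfloor>t\<rfloor>" for s t :: real using that by linarith
  show False
  proof (rule height_gap_contradiction[of x x' "real M"])
    show "x \<in> exceptional_units" "x' \<in> exceptional_units" using x x' by (auto simp: S_def)
    show "height x (1 - x) \<ge> 100 * real d" "height x' (1 - x') \<ge> 7 * height x (1 - x)"
      using x x' by (auto simp: S_def h_def)
    show "real M \<ge> 100 * real d" by (simp add: M_def)
    fix i assume "i < d"
    then show "real M * (ln (norm (\<sigma> i x')) / height x' (1 - x')) \<le> real M * (ln (norm (\<sigma> i x)) / height x (1 - x)) + 1"
      "real M * (ln (norm (\<sigma> i (1 - x'))) / height x' (1 - x')) \<le> real M * (ln (norm (\<sigma> i (1 - x))) / height x (1 - x)) + 1"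
      using eq[of i] by (auto simp: cell_def h_def intro!: floor_close)
  qed
qed

end

section \<open>Simplest cubic polynomials\<close>

text \<open>Transitivity of integrality: the products \<open>n ^ i * z ^ j\<close> with
  \<open>i < degree p\<close> and \<open>j < 3\<close> span a module stable under multiplication by
  \<open>z\<close>.\<close>

lemma algebraic_int_root_cubic:
  fixes z n :: "'a::field_char_0"
  assumes n: "algebraic_int n" and z: "z ^ 3 = n * z ^ 2 + (n + 3) * z + 1"
  shows "algebraic_int z"
proof -
  obtain p :: "int poly" where p: "lead_coeff p = 1" "poly (map_poly of_int p) n = 0"
    using n unfolding algebraic_int_altdef_ipoly by auto
  have pos: "degree p > 0"
    using p by (auto elim!: degree_eq_zeroE intro!: gr0I)
  define I where "I = {..<degree p} \<times> {..<3::nat}"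
  define v where "v = (\<lambda>(i, j). n ^ i * z ^ j)"
  have fin: "finite I" by (simp add: I_def)
  have 0: "(0, 0) \<in> I" using pos by (simp add: I_def)
  have S: "n ^ k * z ^ l \<in> int_integral.hom_span v I" for k l
  proof (induction l arbitrary: k rule: less_induct)
    case (less l)
    show ?case
    proof (cases "l < 3")
      case True
      show ?thesis
      proof (induction k rule: less_induct)
        case (less k)
        show ?case
        proof (cases "k < degree p")
          case k: True
          then show ?thesis using True int_integral.hom_span_base[OF fin, of "(k, l)" v] by (simp add: I_def v_def)
        next
          case False
          then have le: "degree p \<le> k" by simp
          have "n ^ k * z ^ l = (\<Sum>i<degree p. of_int (- coeff p i) * (n ^ (k - degree p + i) * z ^ l))"
            by (subst int_integral.hom_integral_power[OF p le]) (simp only: sum_distrib_right mult.assoc)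
          then show ?thesis
            using False less by (auto intro!: int_integral.hom_span_sum int_integral.hom_span_scale simp del: of_int_minus)
        qed
      qed
    next
      case False
      define j where "j = l - 3"
      have l: "l = j + 3" using False by (simp add: j_def)
      \<comment> \<open>Replacing \<open>z ^ 3\<close> raises the exponent of \<open>n\<close>,
        which is why the outer induction on \<open>l\<close> keeps \<open>k\<close>
        arbitrary.\<close>
      have "n ^ k * z ^ l = n ^ Suc k * z ^ (j + 2)
          + (n ^ Suc k * z ^ (j + 1) + (of_int 3 * (n ^ k * z ^ (j + 1)) + n ^ k * z ^ j))"
        unfolding l power_add z by (simp add: algebra_simps power2_eq_square)
      then show ?thesis
        using less[of "j + 2"] less[of "j + 1"] less[of j] l
        by (auto intro!: int_integral.hom_span_add int_integral.hom_span_scale simp del: power_Suc of_int_numeral)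
    qed
  qed
  have "z * v i \<in> int_integral.hom_span v I" for i
    using S[of "fst i" "Suc (snd i)"] by (simp add: v_def split_beta mult_ac)
  then show ?thesis
    using int_integral.hom_integralI[OF fin 0, of v z]
    by (simp add: v_def algebraic_int_iff_hom_integral)
qed

text \<open>The Galois group permutes the roots by \<open>z \<mapsto> - 1 / (1 + z)\<close>, so that the roots are units
  together with their translates by \<open>1\<close>.\<close>

lemma simplest_cubic_root_units:
  fixes z n :: "'a::field_char_0"
  assumes n: "algebraic_int n" and z: "poly (simplest_cubic n) z = 0"
  shows "z \<noteq> 0" "1 + z \<noteq> 0" "algebraic_int z" "algebraic_int (inverse z)"
    "algebraic_int (1 + z)" "algebraic_int (inverse (1 + z))" "n = (z ^ 3 - 3 * z - 1) / (z ^ 2 + z)"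
proof -
  have eq: "z ^ 3 = n * z ^ 2 + (n + 3) * z + 1" using z by (simp add: poly_simplest_cubic algebra_simps)
  show z0: "z \<noteq> 0" using eq by auto
  show z1: "1 + z \<noteq> 0"
  proof
    assume "1 + z = 0"
    then have "z = -1" by (simp add: eq_neg_iff_add_eq_0 add.commute)
    then show False using eq by (simp add: power3_eq_cube)
  qed
  show zi: "algebraic_int z" by (rule algebraic_int_root_cubic[OF n eq])
  then show "algebraic_int (1 + z)" by (intro algebraic_int_add) auto
  define w where "w = inverse (1 + z)"
  have w: "w * (1 + z) = 1" using z1 by (simp add: w_def)
  \<comment> \<open>The cubic rewritten in \<open>1 + z\<close>; division by
    \<open>(1 + z) ^ 3\<close> shows that \<open>- w = - 1 / (1 + z)\<close> is again a
    root.\<close>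
  have "(1 + z) ^ 3 = (n + 3) * (1 + z) ^ 2 - n * (1 + z) - 1"
    using eq by (simp add: algebra_simps power2_eq_square power3_eq_cube)
  then have "w ^ 3 * (1 + z) ^ 3 = w ^ 3 * ((n + 3) * (1 + z) ^ 2 - n * (1 + z) - 1)" by simp
  also have "\<dots> = (n + 3) * w * (w * (1 + z)) ^ 2 - n * w ^ 2 * (w * (1 + z)) - w ^ 3"
    by (simp only: power2_eq_square power3_eq_cube right_diff_distrib mult_ac mult_1_right mult_1_left)
  finally have "1 = (n + 3) * w - n * w ^ 2 - w ^ 3"
    unfolding power_mult_distrib[symmetric] w by simp
  then have "(- w) ^ 3 = n * (- w) ^ 2 + (n + 3) * (- w) + 1"
    by (simp add: power3_eq_cube power2_eq_square algebra_simps)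
  then have "algebraic_int (- w)" by (rule algebraic_int_root_cubic[OF n])
  then show "algebraic_int (inverse (1 + z))" by (simp add: w_def)
  define u where "u = inverse z"
  have u: "u * z = 1" using z0 by (simp add: u_def)
  have "u ^ 3 * z ^ 3 = u ^ 3 * (n * z ^ 2 + (n + 3) * z + 1)" by (simp only: eq)
  also have "\<dots> = n * u * (u * z) ^ 2 + (n + 3) * u ^ 2 * (u * z) + u ^ 3"
    by (simp only: power2_eq_square power3_eq_cube distrib_left mult_ac mult_1_right mult_1_left)
  finally have "1 = n * u + (n + 3) * u ^ 2 + u ^ 3"
    unfolding power_mult_distrib[symmetric] u by simp
  \<comment> \<open>Applying \<open>z \<mapsto> - 1 / (1 + z)\<close> twice gives
    \<open>- 1 - 1 / z\<close>, so this too is a root.\<close>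
  then have "(- 1 - u) ^ 3 = n * (- 1 - u) ^ 2 + (n + 3) * (- 1 - u) + 1"
    by (simp add: power3_eq_cube power2_eq_square algebra_simps)
  then have "algebraic_int (- 1 - u)" by (rule algebraic_int_root_cubic[OF n])
  from algebraic_int_minus[OF this] have "algebraic_int (- (- 1 - u) - 1)"
    by (rule algebraic_int_diff) simp
  then show "algebraic_int (inverse z)" by (simp add: u_def)
  have "z ^ 2 + z = z * (1 + z)" by (simp add: power2_eq_square algebra_simps)
  then have "z ^ 2 + z \<noteq> 0" using z0 z1 by simp
  moreover have "n * (z ^ 2 + z) = z ^ 3 - 3 * z - 1" unfolding eq by (simp add: algebra_simps)
  ultimately show "n = (z ^ 3 - 3 * z - 1) / (z ^ 2 + z)" by (simp add: eq_divide_eq)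
qed

section \<open>Number fields and splitting fields inside the algebraic closure\<close>

lemma number_field_finite_spanning:
  assumes "number_field TYPE('a::field_char_0)"
  obtains B :: "'a::field_char_0 set" where "finite B" "\<And>x. \<exists>c. x = (\<Sum>b\<in>B. of_rat (c b) * b)"
proof -
  obtain B :: "'a set" where B: "finite_dimensional_vector_space (\<lambda>(q::rat) x. of_rat q * x) B"
    using assms unfolding number_field_def by blast
  interpret V: finite_dimensional_vector_space "\<lambda>(q::rat) x. of_rat q * x :: 'a" B by (rule B)
  have "x \<in> V.span B" for x using V.span_Basis by simp
  then have "\<exists>c. x = (\<Sum>b\<in>B. of_rat (c b) * b)" for x
    unfolding V.span_finite[OF V.finite_Basis] by blast
  then show ?thesis using that V.finite_Basis by blast
qed

text \<open>Multiplication by \<open>x\<close> preserves the span of a finite set over \<rat>, so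
  \<open>hom_integralI\<close> applies.\<close>

lemma number_field_algebraic:
  assumes "number_field TYPE('a::field_char_0)"
  shows "algebraic (x :: 'a::field_char_0)"
proof -
  obtain B :: "'a set" where B: "finite B" "\<And>x. \<exists>c. x = (\<Sum>b\<in>B. of_rat (c b) * b)"
    using number_field_finite_spanning[OF assms] by blast
  have span: "y \<in> rat_integral.hom_span (\<lambda>b. b) B" for y
    using B(2)[of y] unfolding rat_integral.hom_span_def by auto
  obtain b where "b \<in> B" "b \<noteq> 0"
  proof -
    obtain c where "1 = (\<Sum>b\<in>B. of_rat (c b) * b)" using B(2)[of 1] by blast
    then have "\<not> (\<forall>b\<in>B. b = 0)"
      using sum.neutral[of B "\<lambda>b. of_rat (c b) * b"] by force
    then show ?thesis using that by blast
  qed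
  then show ?thesis
    unfolding algebraic_iff_hom_integral using rat_integral.hom_integralI[OF B(1), of b "\<lambda>b. b" x] span by blast
qed

lemma to_ac_poly_of_int:
  fixes x :: "'a::field_char_0"
  shows "to_ac (poly (map_poly of_int p) x) = poly (map_poly of_int p) (to_ac x)"
  by (simp add: poly_altdef to_ac_sum coeff_map_poly)

lemma algebraic_int_to_ac: "algebraic_int x \<Longrightarrow> algebraic_int (to_ac (x :: 'a::field_char_0))"
  unfolding algebraic_int_altdef_ipoly by (metis to_ac_0 to_ac_poly_of_int)

lemma algebraic_to_ac: "algebraic x \<Longrightarrow> algebraic (to_ac (x :: 'a::field_char_0))"
  by (elim algebraicE', rule algebraicI'[where p = "map_poly of_int _"])
    (auto simp: coeff_map_poly simp flip: to_ac_poly_of_int)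

lemma to_ac_of_rat: "to_ac (of_rat q :: 'a::field_char_0) = of_rat q"
  by (cases q) (simp add: of_rat_rat)

lemma map_poly_to_ac_simplest_cubic:
  "map_poly to_ac (simplest_cubic m) = simplest_cubic (to_ac (m :: 'a::field_char_0))"
  by (rule poly_eqI)
    (auto simp: simplest_cubic_def coeff_map_poly coeff_pCons split: nat.splits)

lemma subfield_rat_adjoin:
  assumes "algebraic (\<theta> :: 'a::field_char_0)"
  shows "subfield (rat_adjoin \<theta>) ring_of_type_algebra"
proof -
  let ?R = "ring_of_type_algebra :: 'a ring"
  interpret R: Ring.field ?R by (rule field_from_type_algebra)
  have uminus: "\<ominus>\<^bsub>?R\<^esub> x = - x" for x
    by (rule R.minus_equality) (simp_all add: ring_of_type_algebra_def)
  show ?thesis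
  proof (rule R.subfieldI')
    show "subring (rat_adjoin \<theta>) ?R"
      by (rule R.subringI)
        (simp_all only: uminus, auto simp: ring_of_type_algebra_def rat_adjoin_add rat_adjoin_mult rat_adjoin_minus)
    fix k assume k: "k \<in> rat_adjoin \<theta> - {\<zero>\<^bsub>?R\<^esub>}"
    then have "k \<noteq> 0" by (simp add: ring_of_type_algebra_def)
    then have "inv\<^bsub>?R\<^esub> k = inverse k"
      by (intro R.comm_inv_char) (simp_all add: ring_of_type_algebra_def)
    then show "inv\<^bsub>?R\<^esub> k \<in> rat_adjoin \<theta>" using k rat_adjoin_inverse[OF assms] by simp
  qed
qed

text \<open>\<open>\<theta>\<close> is a primitive element for the roots together with the image of
  a finite set spanning the base field over \<rat>; minimality of the splitting field gives the
  inclusion.\<close>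

lemma splitting_field_subset_rat_adjoin:
  fixes m :: "'a::field_char_0"
  assumes nf: "number_field TYPE('a)" and m: "algebraic_int m"
  obtains \<theta> where "algebraic \<theta>" "splitting_field (simplest_cubic m) \<subseteq> rat_adjoin \<theta>"
proof -
  obtain B :: "'a set" where B: "finite B" "\<And>x. \<exists>c. x = (\<Sum>b\<in>B. of_rat (c b) * b)"
    using number_field_finite_spanning[OF nf] by blast
  let ?R = "{x. poly (simplest_cubic (to_ac m)) x = 0}"
  have "finite ?R" by (rule poly_roots_finite) (simp add: simplest_cubic_def)
  moreover have "algebraic x" if "x \<in> to_ac ` B \<union> ?R" for x
    using that simplest_cubic_root_units(3)[OF algebraic_int_to_ac[OF m]] algebraic_to_ac number_field_algebraic[OF nf]
    by (auto intro: algebraic_int_imp_algebraic)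
  ultimately obtain \<theta> where \<theta>: "algebraic \<theta>" "to_ac ` B \<union> ?R \<subseteq> rat_adjoin \<theta>"
    using primitive_element_finite[of "to_ac ` B \<union> ?R"] B(1) by blast
  have "to_ac x \<in> rat_adjoin \<theta>" for x :: 'a
  proof -
    obtain c where "x = (\<Sum>b\<in>B. of_rat (c b) * b)" using B(2)[of x] by blast
    then have "to_ac x = (\<Sum>b\<in>B. of_rat (c b) * to_ac b)" by (simp add: to_ac_sum to_ac_of_rat)
    then show ?thesis using \<theta>(2) by (auto intro!: rat_adjoin_sum rat_adjoin_mult)
  qed
  then have "splitting_field (simplest_cubic m) \<subseteq> rat_adjoin \<theta>"
    using \<theta>(2) by (intro splitting_field_least subfield_rat_adjoin[OF \<theta>(1)])
      (auto simp: map_poly_to_ac_simplest_cubic)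
  then show ?thesis using that \<theta>(1) by blast
qed

theorem corollary5p6:
  fixes m :: "'a::field_char_0"
  assumes "number_field TYPE('a)"
    and "algebraic_int m"
    and "m ^ 2 + 3 * m + 9 \<noteq> 0"
  shows "finite {n :: 'a. algebraic_int n \<and>
           splitting_field (simplest_cubic m) = splitting_field (simplest_cubic n)}"
proof -
  let ?T = "{n :: 'a. algebraic_int n \<and> splitting_field (simplest_cubic m) = splitting_field (simplest_cubic n)}"
  obtain \<theta> where \<theta>: "algebraic \<theta>" "splitting_field (simplest_cubic m) \<subseteq> rat_adjoin \<theta>"
    using splitting_field_subset_rat_adjoin[OF assms(1,2)] by blast
  obtain d \<sigma> where "number_embeddings (rat_adjoin \<theta>) d \<sigma>"
    using rat_adjoin_embeddings[OF \<theta>(1)] by blast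
  then interpret number_embeddings "rat_adjoin \<theta>" d \<sigma> .
  \<comment> \<open>With \<open>w = - z\<close> one has \<open>1 - w = 1 + z\<close>, so a root
    gives an exceptional unit from which \<open>n\<close> is recovered.\<close>
  have "to_ac ` ?T \<subseteq> (\<lambda>w. ((- w) ^ 3 - 3 * (- w) - 1) / ((- w) ^ 2 + (- w))) ` exceptional_units"
  proof (intro image_subsetI)
    fix n assume n: "n \<in> ?T"
    have "\<exists>z. poly (simplest_cubic (to_ac n)) z = 0"
      by (rule alg_closed_imp_poly_has_root) (simp add: simplest_cubic_def)
    then obtain z where z: "poly (simplest_cubic (to_ac n)) z = 0" by blast
    then have "z \<in> splitting_field (simplest_cubic n)"
      unfolding splitting_field_def map_poly_to_ac_simplest_cubic by (intro generate_field.incl) auto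
    \<comment> \<open>The coincidence of the splitting fields enters here: a root belonging to
      \<open>n\<close> lies in a field that depends on \<open>m\<close> alone.\<close>
    then have zK: "z \<in> rat_adjoin \<theta>" using n \<theta>(2) by auto
    have u: "algebraic_int (to_ac n)" using n algebraic_int_to_ac by auto
    note units = simplest_cubic_root_units[OF u z]
    have "unit_elt (- z)" "unit_elt (1 - (- z))"
      unfolding unit_elt_def using units zK by (auto intro: minus_closed add_closed one_closed)
    then have "- z \<in> exceptional_units" by (simp add: exceptional_units_def)
    then show "to_ac n \<in> (\<lambda>w. ((- w) ^ 3 - 3 * (- w) - 1) / ((- w) ^ 2 + (- w))) ` exceptional_units"
      using units(7) by (intro image_eqI[of _ _ "- z"]) auto
  qed
  then have "finite (to_ac ` ?T)" by (rule finite_subset) (intro finite_imageI finite_exceptional_units)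
  then show ?thesis by (rule finite_imageD) (rule inj_on_subset[OF inj_to_ac subset_UNIV])
qed

end
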